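(* Let $m,n\in\mathbb{N}\cup\{0\}$ and $G \in \mathcal{G}_{m,n}$. Then there is an acyclic matching $\mathcal{V}$ on $\mathcal{I}(G)$ such that all $\mathcal{V}$-critical simplices, except possibly one $0$-simplex, are maximal simplices of $\mathcal{I}(G)$. As a consequence, if $|V(G)|\geq 2$, then \[\mathcal{I}(G) \simeq \bigvee_{f_0^{\mathcal{V}}-1}\mathbb{S}^0 \vee \bigvee_{f_1^{\mathcal{V}}}\mathbb{S}^1 \vee \bigvee_{f_2^{\mathcal{V}}}\mathbb{S}^2 \vee \cdots \vee \bigvee_{f_d^{\mathcal{V}}}\mathbb{S}^d,\] where $d = \dim(\mathcal{I}(G)) = \min\{m,n\}$.
   Context: For $m,n \in \mathbb{N}\cup\{0\}$, $\mathcal{G}_{m,n}$ is the class of finite simple graphs whose vertex set is a disjoint union $V = \bigsqcup_{i=0}^{m}\bigsqcup_{j=0}^{n} V_{i,j}$ with each $V_{i,j}\neq\emptyset$, where distinct vertices $x \in V_{i_1,j_1}$ and $y \in V_{i_2,j_2}$ are adjacent if and only if ($i_1 \le i_2$ and $j_1 \le j_2$) or ($i_1 \ge i_2$ and $j_1 \ge j_2$). The independence complex $\mathcal{I}(G)$ is the simplicial complex of all independent sets of $G$ (including $\emptyset$). An acyclic matching on a simplicial complex $\mathcal{X}$ is a set $\mathcal{V}$ of pairs $(\alpha,\beta)$ of simplices with $\alpha \subseteq \beta$, $\dim\beta=\dim\alpha+1$ (the empty simplex allowed), each simplex in at most one pair, such that reversing the edges of $\mathcal{V}$ in the directed Hasse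 diagram of $\mathcal{X}$ yields no directed cycle. A non-empty simplex is $\mathcal{V}$-critical if it is unpaired or paired with $\emptyset$; $f_i^{\mathcal{V}}$ is the number of $i$-dimensional $\mathcal{V}$-critical simplices. $\simeq$ is homotopy equivalence; $\bigvee_t\mathbb{S}^i$ is a wedge of $t$ copies of the $i$-sphere (zero copies contribute nothing). *)

theory Defs
  imports "HOL-Analysis.Analysis" "Graph_Theory.Pair_Digraph"
begin

section \<open>The graph class and the independence complex\<close>

text \<open>
  A finite simple graph is a \<^locale>\<open>pair_graph\<close>: a finite vertex set with a
  symmetric irreflexive adjacency relation \<^const>\<open>parcs\<close>.
\<close>

definition grid_graph :: "nat \<Rightarrow> nat \<Rightarrow> 'a pair_pre_digraph \<Rightarrow> bool" where
  "grid_graph m n G \<longleftrightarrow>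
     pair_graph G \<and>
     (\<exists>W :: nat \<Rightarrow> nat \<Rightarrow> 'a set.
        pverts G = (\<Union>i\<le>m. \<Union>j\<le>n. W i j) \<and>
        disjoint_family_on (\<lambda>(i, j). W i j) ({..m} \<times> {..n}) \<and>
        (\<forall>i\<le>m. \<forall>j\<le>n. W i j \<noteq> {}) \<and>
        (\<forall>i1\<le>m. \<forall>j1\<le>n. \<forall>i2\<le>m. \<forall>j2\<le>n. \<forall>x\<in>W i1 j1. \<forall>y\<in>W i2 j2. x \<noteq> y \<longrightarrow>
           ((x, y) \<in> parcs G \<longleftrightarrow> i1 \<le> i2 \<and> j1 \<le> j2 \<or> i1 \<ge> i2 \<and> j1 \<ge> j2)))"

definition independence_complex :: "'a pair_pre_digraph \<Rightarrow> 'a set set" where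
  "independence_complex G =
     {S. S \<subseteq> pverts G \<and> (\<forall>x\<in>S. \<forall>y\<in>S. x \<noteq> y \<longrightarrow> (x, y) \<notin> parcs G)}"


section \<open>Finite abstract simplicial complexes and acyclic matchings\<close>

text \<open>
  A finite abstract simplicial complex is represented by the set of its simplices,
  including the empty simplex, whose dimension is \<open>-1\<close>.
\<close>

definition sdim :: "'a set \<Rightarrow> int" where
  "sdim \<sigma> = int (card \<sigma>) - 1"

definition complex_dim :: "'a set set \<Rightarrow> int" where
  "complex_dim X = Max (sdim ` X)"

definition maximal_simplex :: "'a set set \<Rightarrow> 'a set \<Rightarrow> bool" where
  "maximal_simplex X \<sigma> \<longleftrightarrow> \<sigma> \<in> X \<and> (\<forall>\<tau>\<in>X. \<sigma> \<subseteq> \<tau> \<longrightarrow> \<tau> = \<sigma>)"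

text \<open>The edges of the Hasse diagram point downwards, from a simplex to its facets.\<close>

definition hasse :: "'a set set \<Rightarrow> ('a set \<times> 'a set) set" where
  "hasse X = {(\<beta>, \<alpha>). \<beta> \<in> X \<and> \<alpha> \<in> X \<and> \<alpha> \<subseteq> \<beta> \<and> sdim \<beta> = sdim \<alpha> + 1}"

definition acyclic_matching :: "'a set set \<Rightarrow> ('a set \<times> 'a set) set \<Rightarrow> bool" where
  "acyclic_matching X M \<longleftrightarrow>
     (\<forall>(\<alpha>, \<beta>)\<in>M. \<alpha> \<in> X \<and> \<beta> \<in> X \<and> \<alpha> \<subseteq> \<beta> \<and> sdim \<beta> = sdim \<alpha> + 1) \<and>
     (\<forall>(\<alpha>, \<beta>)\<in>M. \<forall>(\<alpha>', \<beta>')\<in>M. {\<alpha>, \<beta>} \<inter> {\<alpha>', \<beta>'} \<noteq> {} \<longrightarrow> (\<alpha>, \<beta>) = (\<alpha>', \<beta>')) \<and>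
     acyclic ((hasse X - M\<inverse>) \<union> M)"

definition critical_simplex :: "'a set set \<Rightarrow> ('a set \<times> 'a set) set \<Rightarrow> 'a set \<Rightarrow> bool" where
  "critical_simplex X M \<sigma> \<longleftrightarrow>
     \<sigma> \<in> X \<and> \<sigma> \<noteq> {} \<and> ((\<forall>(\<alpha>, \<beta>)\<in>M. \<sigma> \<noteq> \<alpha> \<and> \<sigma> \<noteq> \<beta>) \<or> ({}, \<sigma>) \<in> M)"

definition num_critical :: "'a set set \<Rightarrow> ('a set \<times> 'a set) set \<Rightarrow> nat \<Rightarrow> nat" where
  "num_critical X M i = card {\<sigma>. critical_simplex X M \<sigma> \<and> sdim \<sigma> = int i}"


section \<open>Geometric realization\<close>

text \<open>
  Points are given by their barycentric coordinates. Only finite complexes are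
  considered, so the subspace topology inherited from the product topology agrees with
  the weak topology.
\<close>

definition geometric_realization :: "'a set set \<Rightarrow> ('a \<Rightarrow> real) topology" where
  "geometric_realization X = subtopology (powertop_real UNIV)
     {x. (\<forall>v. 0 \<le> x v) \<and> {v. x v \<noteq> 0} \<in> X \<and> (\<Sum>v | x v \<noteq> 0. x v) = 1}"


section \<open>Wedges of spheres\<close>

text \<open>
  The wedge is the quotient of the disjoint union that identifies all the base points
  \<open>p i\<close> to the single point \<^term>\<open>None\<close>. The point \<^term>\<open>None\<close> is put in separately, so
  that the empty wedge is a one-point space.
\<close>

definition wedge_proj :: "('i \<Rightarrow> 'b) \<Rightarrow> 'i \<times> 'b \<Rightarrow> ('i \<times> 'b) option" where
  "wedge_proj p = (\<lambda>(i, x). if x = p i then None else Some (i, x))"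

definition wedge :: "('i \<Rightarrow> 'b topology) \<Rightarrow> 'i set \<Rightarrow> ('i \<Rightarrow> 'b) \<Rightarrow> ('i \<times> 'b) option topology" where
  "wedge X I p = topology (\<lambda>U.
     U \<subseteq> insert None (wedge_proj p ` topspace (sum_topology X I)) \<and>
     openin (sum_topology X I) {z \<in> topspace (sum_topology X I). wedge_proj p z \<in> U})"

lemma istopology_wedge:
  "istopology (\<lambda>U.
     U \<subseteq> insert None (wedge_proj p ` topspace S) \<and>
     openin S {z \<in> topspace S. wedge_proj p z \<in> U})"
proof -
  have 1: "{z \<in> topspace S. wedge_proj p z \<in> A \<inter> B} =
      {z \<in> topspace S. wedge_proj p z \<in> A} \<inter> {z \<in> topspace S. wedge_proj p z \<in> B}" for A B
    by auto
  have 2: "{z \<in> topspace S. wedge_proj p z \<in> \<Union>K} =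
      (\<Union>A\<in>K. {z \<in> topspace S. wedge_proj p z \<in> A})" for K
    by auto
  show ?thesis
    unfolding istopology_def 1 2 by blast
qed

lemma openin_wedge:
  "openin (wedge X I p) U \<longleftrightarrow>
     U \<subseteq> insert None (wedge_proj p ` topspace (sum_topology X I)) \<and>
     openin (sum_topology X I) {z \<in> topspace (sum_topology X I). wedge_proj p z \<in> U}"
  by (simp only: wedge_def topology_inverse'[OF istopology_wedge])

lemma topspace_wedge:
  "topspace (wedge X I p) = insert None (wedge_proj p ` topspace (sum_topology X I))"
proof (rule subset_antisym)
  show "topspace (wedge X I p) \<subseteq> insert None (wedge_proj p ` topspace (sum_topology X I))"
    using openin_topspace[of "wedge X I p"] unfolding openin_wedge by (rule conjunct1)
  have "{z \<in> topspace (sum_topology X I).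
      wedge_proj p z \<in> insert None (wedge_proj p ` topspace (sum_topology X I))} =
    topspace (sum_topology X I)"
    by blast
  then have "openin (wedge X I p) (insert None (wedge_proj p ` topspace (sum_topology X I)))"
    by (simp only: openin_wedge openin_topspace subset_refl simp_thms)
  then show "insert None (wedge_proj p ` topspace (sum_topology X I)) \<subseteq> topspace (wedge X I p)"
    by (rule openin_subset)
qed

lemma quotient_map_wedge:
  assumes "I \<noteq> {}" and "\<And>i. i \<in> I \<Longrightarrow> p i \<in> topspace (X i)"
  shows "quotient_map (sum_topology X I) (wedge X I p) (wedge_proj p)"
proof -
  obtain i where "i \<in> I" using assms(1) by blast
  then have "(i, p i) \<in> topspace (sum_topology X I)" "wedge_proj p (i, p i) = None"
    using assms(2) by (auto simp: wedge_proj_def)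
  then have "None \<in> wedge_proj p ` topspace (sum_topology X I)"
    by (simp only: rev_image_eqI)
  then have "insert None (wedge_proj p ` topspace (sum_topology X I)) =
      wedge_proj p ` topspace (sum_topology X I)"
    by (rule insert_absorb)
  then show ?thesis
    unfolding quotient_map_def openin_wedge topspace_wedge by (auto simp only:)
qed

text \<open>
  The wedge of \<open>t i\<close> copies of the \<open>i\<close>-sphere for each \<open>i \<le> d\<close>. Note that \<^term>\<open>nsphere 0\<close>
  consists of two points; the base point of each sphere is the first unit vector.
\<close>

definition sphere_wedge ::
    "nat \<Rightarrow> (nat \<Rightarrow> nat) \<Rightarrow> ((nat \<times> nat) \<times> (nat \<Rightarrow> real)) option topology" where
  "sphere_wedge d t =
     wedge (\<lambda>(i, k). nsphere i) {(i, k). i \<le> d \<and> k < t i} (\<lambda>_ j. if j = 0 then 1 else 0)"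

lemma sphere_base_point: "(\<lambda>j. if j = 0 then 1 else 0) \<in> topspace (nsphere i)"
proof -
  have "(\<Sum>j\<le>i. (if j = 0 then 1 else 0 :: real)\<^sup>2) = (\<Sum>j\<le>i. if j = 0 then 1 else 0)"
    by (intro sum.cong) auto
  then show ?thesis
    by (simp add: nsphere)
qed

end

theory Submission
  imports Defs
begin

text \<open>
  After reversing the second coordinate, the independent sets of the graph are the chains of the
  strict product order on a grid all of whose cells are nonempty. Fix a vertex \<open>u\<close> in the corner
  cell. The other vertices of the first row and the first column are pairwise incomparable, and so a
  chain contains at most one of them. A chain meeting the first row and column at most in \<open>u\<close> is
  matched by adding or removing \<open>u\<close>; a chain whose least element is another vertex \<open>r\<close> there is
  \<open>r\<close> together with a chain of the smaller grid above \<open>r\<close>, and is matched recursively. A chain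
  remains unmatched only if the recursion arrives at an empty grid, and then it is maximal.

  The matched simplices form a complex that collapses to the vertex \<open>u\<close>. Its realization is
  therefore contractible, so that the whole realization is homotopy equivalent to its quotient by
  this subspace, in which every remaining facet becomes a sphere.
\<close>

section \<open>Acyclic matchings from sequences of expansions\<close>

text \<open>The matching is recorded as a sequence of inverse elementary collapses and not merely as
  a set of pairs, because both conclusions then follow by induction over one object: each new pair
  receives ranks above all earlier ones, which excludes directed cycles, and each new pair is undone
  by a deformation retraction, which gives contractibility. Since all unpaired simplices are facets,
  they can be deleted simultaneously, and no order of cell attachments has to be followed. The
  obstacle is topological. Passing to the quotient by a contractible subspace needs the contraction
  to extend to a homotopy of the whole space. The extension is written down explicitly, controlled
  by the least barycentric coordinate on a facet, which is positive inside and 0 on the boundary.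
  The same function serves to parametrize the spheres. By maximality at most one facet has a
  positive value at a given point, so formulas that sum over all facets are continuous and still
  reduce to one term.\<close>

definition finite_complex :: "'a set set \<Rightarrow> bool" where
  "finite_complex X \<longleftrightarrow> finite X \<and> (\<forall>S\<in>X. finite S) \<and> (\<forall>S\<in>X. \<forall>T. T \<subseteq> S \<longrightarrow> T \<in> X)"

lemma finite_complexD:
  assumes "finite_complex X"
  shows "finite X" "S \<in> X \<Longrightarrow> finite S" "S \<in> X \<Longrightarrow> T \<subseteq> S \<Longrightarrow> T \<in> X"
  using assms unfolding finite_complex_def by blast+

lemma finite_complexI:
  assumes "finite X" "\<And>S. S \<in> X \<Longrightarrow> finite S" "\<And>S T. S \<in> X \<Longrightarrow> T \<subseteq> S \<Longrightarrow> T \<in> X"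
  shows "finite_complex X"
  using assms unfolding finite_complex_def by blast

text \<open>Complexes obtained from a vertex by inverse elementary collapses, together with the pairs
  of simplices added on the way, the first of which is the pair of the empty simplex and the
  vertex.\<close>

inductive expansion :: "'a set set \<Rightarrow> ('a set \<times> 'a set) set \<Rightarrow> bool" where
  base: "expansion {{}, {u}} {({}, {u})}"
| step: "expansion K M \<Longrightarrow> \<alpha> \<noteq> {} \<Longrightarrow> finite \<alpha> \<Longrightarrow> u \<notin> \<alpha> \<Longrightarrow> \<alpha> \<notin> K \<Longrightarrow> insert u \<alpha> \<notin> K \<Longrightarrow>
    (\<And>x. x \<in> \<alpha> \<Longrightarrow> insert u (\<alpha> - {x}) \<in> K) \<Longrightarrow>
    expansion (K \<union> {\<alpha>, insert u \<alpha>}) (insert (\<alpha>, insert u \<alpha>) M)"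

lemma expansion_complex: "expansion K M \<Longrightarrow> finite_complex K"
proof (induction rule: expansion.induct)
  case (base u)
  then show ?case by (auto simp: finite_complex_def)
next
  case (step K M \<alpha> u)
  have down: "T \<in> K" if "S \<in> K" "T \<subseteq> S" for S T
    using step.IH that unfolding finite_complex_def by blast
  \<comment> \<open>A face that misses some \<open>x\<close> of \<open>\<alpha>\<close> lies in
    \<open>insert u (\<alpha> - {x})\<close>, which is already in \<open>K\<close>; a face that
    misses none is one of the two new simplices.\<close>
  have "T \<in> K \<union> {\<alpha>, insert u \<alpha>}" if T: "T \<subseteq> insert u \<alpha>" for T
  proof (cases "\<exists>x\<in>\<alpha>. x \<notin> T")
    case True
    then obtain x where "x \<in> \<alpha>" "x \<notin> T" by blast
    then show ?thesis
      using down[OF step.hyps(7)[of x], of T] T by blast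
  next
    case False
    then have "T = \<alpha> \<or> T = insert u \<alpha>" using T by blast
    then show ?thesis by blast
  qed
  moreover have "finite (K \<union> {\<alpha>, insert u \<alpha>})" "\<forall>S\<in>K \<union> {\<alpha>, insert u \<alpha>}. finite S"
    using step unfolding finite_complex_def by auto
  ultimately show ?case
    using down unfolding finite_complex_def by (metis Un_iff insertE singletonD subset_insertI2)
qed

lemma expansion_pair_mem: "expansion K M \<Longrightarrow> (\<alpha>, \<beta>) \<in> M \<Longrightarrow> \<alpha> \<in> K \<and> \<beta> \<in> K"
  by (induction rule: expansion.induct) auto

lemma expansion_empty_mem: "expansion K M \<Longrightarrow> {} \<in> K"
  by (induction rule: expansion.induct) auto

text \<open>The pairs \<open>(S, insert u S)\<close> can be added in order of nondecreasing
  cardinality. The induction therefore strips off an \<open>\<alpha>\<close> of greatest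
  cardinality: its removal leaves a complex, and every facet of \<open>insert u \<alpha>\<close>
  through \<open>u\<close> is present before the pair is added back.\<close>

lemma expansion_cone:
  assumes "finite_complex K" "{} \<in> K" "u \<notin> \<Union>K"
  shows "\<exists>M. expansion (K \<union> insert u ` K) M"
  using assms
proof (induction "card K" arbitrary: K)
  case 0
  then show ?case using finite_complexD(1)[of K] by auto
next
  case (Suc k)
  have finK: "finite K" using finite_complexD(1)[OF Suc.prems(1)] .
  show ?case
  proof (cases "K = {{}}")
    case True
    then show ?thesis using expansion.base[of u] by (auto simp: insert_commute)
  next
    case False
    obtain \<alpha> where max: "\<alpha> \<in> K" "\<And>S. S \<in> K \<Longrightarrow> card S \<le> card \<alpha>"
      using Lattices_Big.ex_has_greatest_nat[of "\<lambda>S. S \<in> K" "{}" card "Suc (Max (card ` K))"]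
        finK Suc.prems(2)
      by (auto simp: less_Suc_eq_le)
    have fin: "finite \<alpha>" and fin': "\<And>S. S \<in> K \<Longrightarrow> finite S"
      using finite_complexD(2)[OF Suc.prems(1)] max(1) by blast+
    have ne: "\<alpha> \<noteq> {}"
    proof
      assume "\<alpha> = {}"
      then have "S = {}" if "S \<in> K" for S
        using max(2)[OF that] fin'[OF that] by simp
      then show False using False Suc.prems(2) by blast
    qed
    have "finite_complex (K - {\<alpha>})"
    proof -
      have "T \<noteq> \<alpha>" if "S \<in> K - {\<alpha>}" "T \<subseteq> S" for S T
        using that max(2)[of S] fin'[of S] by (metis DiffD1 DiffD2 card_seteq insertI1)
      then show ?thesis
        using finite_complexD[OF Suc.prems(1)] by (intro finite_complexI) auto
    qed
    moreover have "k = card (K - {\<alpha>})"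
      using Suc.hyps(2) max(1) finK by simp
    ultimately obtain M where M: "expansion (K - {\<alpha>} \<union> insert u ` (K - {\<alpha>})) M"
      using Suc.hyps(1)[of "K - {\<alpha>}"] Suc.prems ne by blast
    have u: "u \<notin> S" if "S \<in> K" for S using that Suc.prems(3) by blast
    have "insert u \<alpha> \<notin> insert u ` (K - {\<alpha>})"
      using u max(1) by (auto simp: insert_ident)
    have "expansion ((K - {\<alpha>} \<union> insert u ` (K - {\<alpha>})) \<union> {\<alpha>, insert u \<alpha>})
        (insert (\<alpha>, insert u \<alpha>) M)"
    proof (rule expansion.step[OF M ne fin u[OF max(1)]])
      show "\<alpha> \<notin> K - {\<alpha>} \<union> insert u ` (K - {\<alpha>})" using u[OF max(1)] by blast
      show "insert u \<alpha> \<notin> K - {\<alpha>} \<union> insert u ` (K - {\<alpha>})"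
        using \<open>insert u \<alpha> \<notin> insert u ` (K - {\<alpha>})\<close> u by blast
      fix x assume "x \<in> \<alpha>"
      then have "\<alpha> - {x} \<in> K - {\<alpha>}"
        using finite_complexD(3)[OF Suc.prems(1) max(1), of "\<alpha> - {x}"] by blast
      then show "insert u (\<alpha> - {x}) \<in> K - {\<alpha>} \<union> insert u ` (K - {\<alpha>})" by blast
    qed
    moreover have "(K - {\<alpha>} \<union> insert u ` (K - {\<alpha>})) \<union> {\<alpha>, insert u \<alpha>} = K \<union> insert u ` K"
      using max(1) by blast
    ultimately show ?thesis by auto
  qed
qed

text \<open>Inserting \<open>r\<close> into both members of each pair of \<open>L\<close> gives
  pairs outside \<open>K\<close>, in an admissible order: the facet opposite \<open>r\<close> is in
  \<open>L \<subseteq> K\<close>, and the others come from earlier pairs of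
  \<open>L\<close>.\<close>

lemma expansion_add_cone:
  assumes "expansion L N" "expansion K M" "L \<subseteq> K" "r \<notin> \<Union>K"
  shows "\<exists>M'. expansion (K \<union> insert r ` L) M'"
  using assms
proof (induction rule: expansion.induct)
  case (base u)
  \<comment> \<open>The pair of the empty simplex and \<open>{u}\<close> becomes the pair of
    \<open>{r}\<close> and \<open>{r, u}\<close>, so the new vertex is matched and the empty simplex
    keeps its partner in \<open>K\<close>.\<close>
  have "expansion (K \<union> {{r}, insert u {r}}) (insert ({r}, insert u {r}) M)"
    using base by (intro expansion.step) auto
  then show ?case by (auto simp: insert_commute)
next
  case (step L N \<alpha> u)
  obtain M' where M': "expansion (K \<union> insert r ` L) M'"
    using step by blast
  have new: "insert r T \<notin> K \<union> insert r ` L" if "T \<in> K" "T \<notin> L" for T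
  proof -
    have "r \<notin> T" using that step.prems by blast
    moreover have "r \<notin> S" if "S \<in> L" for S using that step.prems by blast
    ultimately have "insert r T \<notin> insert r ` L"
      using that by (auto simp: insert_ident)
    then show ?thesis using step.prems by blast
  qed
  have mem: "\<alpha> \<in> K" "insert u \<alpha> \<in> K" using step.prems by auto
  have r: "r \<notin> \<alpha>" "r \<noteq> u" using mem step.prems by auto
  have "insert u (insert r \<alpha> - {x}) \<in> K \<union> insert r ` L" if "x \<in> insert r \<alpha>" for x
  proof (cases "x = r")
    case True
    then show ?thesis using mem r by simp
  next
    case False
    then have "insert u (insert r \<alpha> - {x}) = insert r (insert u (\<alpha> - {x}))" by blast
    then show ?thesis using step.hyps(7)[of x] False that by blast
  qed
  then have "expansion ((K \<union> insert r ` L) \<union> {insert r \<alpha>, insert u (insert r \<alpha>)})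
      (insert (insert r \<alpha>, insert u (insert r \<alpha>)) M')"
    using M' step.hyps(3-4) r r(2)[symmetric] new[OF mem(1) step.hyps(5)] new[OF mem(2) step.hyps(6)]
      \<open>\<And>x. x \<in> insert r \<alpha> \<Longrightarrow> insert u (insert r \<alpha> - {x}) \<in> K \<union> insert r ` L\<close>
    by (intro expansion.step) (simp_all only: insert_commute[of u r] insert_iff finite_insert
      insert_not_empty de_Morgan_disj simp_thms)
  moreover have "(K \<union> insert r ` L) \<union> {insert r \<alpha>, insert u (insert r \<alpha>)} =
      K \<union> insert r ` (L \<union> {\<alpha>, insert u \<alpha>})"
    by (auto simp: insert_commute)
  ultimately show ?case by auto
qed

text \<open>A function decreasing along all edges of the modified Hasse diagram witnesses that it has no
  directed cycle, and it extends to an enlarged complex.\<close>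

definition matching_rank :: "'a set set \<Rightarrow> ('a set \<times> 'a set) set \<Rightarrow> ('a set \<Rightarrow> nat) \<Rightarrow> bool" where
  "matching_rank X M h \<longleftrightarrow> (\<forall>(x, y) \<in> (hasse X - M\<inverse>) \<union> M. h y < h x)"

lemma hasseD:
  assumes "(\<beta>, \<alpha>) \<in> hasse X"
  shows "\<beta> \<in> X" "\<alpha> \<in> X" "\<alpha> \<subseteq> \<beta>" "\<beta> \<noteq> \<alpha>"
  using assms unfolding hasse_def by auto

lemma matching_rankI:
  "(\<And>x y. (x, y) \<in> (hasse X - M\<inverse>) \<union> M \<Longrightarrow> h y < h x) \<Longrightarrow> matching_rank X M h"
  unfolding matching_rank_def by blast

lemma matching_rankD:
  "matching_rank X M h \<Longrightarrow> (x, y) \<in> (hasse X - M\<inverse>) \<union> M \<Longrightarrow> h y < h x"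
  unfolding matching_rank_def by blast

lemma matching_rank_acyclic: "matching_rank X M h \<Longrightarrow> acyclic ((hasse X - M\<inverse>) \<union> M)"
proof -
  assume h: "matching_rank X M h"
  have "(y, x) \<in> inv_image less_than h" if "(x, y) \<in> (hasse X - M\<inverse>) \<union> M" for x y
    using matching_rankD[OF h that] by simp
  then have "((hasse X - M\<inverse>) \<union> M)\<inverse> \<subseteq> inv_image less_than h"
    by (intro subrelI) (simp only: converse_iff)
  then have "wf (((hasse X - M\<inverse>) \<union> M)\<inverse>)"
    using wf_inv_image[OF wf_less_than] wf_subset by blast
  then show ?thesis
    by (metis acyclic_converse wf_acyclic)
qed

text \<open>The rank is stated besides the acyclicity because
  \<open>acyclic_matching_add_facets\<close> extends it. That the pairs exhaust \<open>K\<close>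
  identifies the critical simplices later.\<close>

lemma expansion_matching:
  assumes "expansion K M"
  shows "acyclic_matching K M" "\<exists>h. matching_rank K M h" "Domain M \<union> Range M = K"
    "\<exists>u. ({}, {u}) \<in> M"
proof -
  have pairs: "(\<forall>(\<alpha>, \<beta>)\<in>M. \<alpha> \<in> K \<and> \<beta> \<in> K \<and> \<alpha> \<subseteq> \<beta> \<and> sdim \<beta> = sdim \<alpha> + 1) \<and>
     (\<forall>(\<alpha>, \<beta>)\<in>M. \<forall>(\<alpha>', \<beta>')\<in>M. {\<alpha>, \<beta>} \<inter> {\<alpha>', \<beta>'} \<noteq> {} \<longrightarrow> (\<alpha>, \<beta>) = (\<alpha>', \<beta>')) \<and>
     Domain M \<union> Range M = K \<and> (\<exists>u. ({}, {u}) \<in> M)"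
    using assms
  proof (induction rule: expansion.induct)
    case (base u)
    then show ?case by (auto simp: sdim_def)
  next
    case (step K M \<alpha> u)
    let ?e = "(\<alpha>, insert u \<alpha>)"
    have in_K: "fst p \<in> K" "snd p \<in> K" if "p \<in> M" for p
      using expansion_pair_mem[OF step.hyps(1), of "fst p" "snd p"] that by simp_all
    have disj: "{\<alpha>, insert u \<alpha>} \<inter> {fst p, snd p} = {}" if "p \<in> M" for p
      using in_K[OF that] step.hyps(5,6) by auto
    have "p = q" if "p \<in> insert ?e M" "q \<in> insert ?e M" "{fst p, snd p} \<inter> {fst q, snd q} \<noteq> {}" for p q
    proof -
      consider "p = ?e" "q = ?e" | "p = ?e" "q \<in> M" | "p \<in> M" "q = ?e" | "p \<in> M" "q \<in> M"
        using \<open>p \<in> _\<close> \<open>q \<in> _\<close> by blast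
      then show ?thesis
      proof cases
        case 1
        then show ?thesis by simp
      next
        case 2
        then show ?thesis using disj[of q] that(3) by simp
      next
        case 3
        then show ?thesis using disj[of p] that(3) by (simp add: Int_commute)
      next
        case 4
        then show ?thesis
          using step.IH that(3) by (metis (mono_tags, lifting) case_prod_unfold prod.collapse)
      qed
    qed
    then have "\<forall>(\<gamma>, \<delta>)\<in>insert ?e M. \<forall>(\<gamma>', \<delta>')\<in>insert ?e M.
        {\<gamma>, \<delta>} \<inter> {\<gamma>', \<delta>'} \<noteq> {} \<longrightarrow> (\<gamma>, \<delta>) = (\<gamma>', \<delta>')"
      by (simp only: case_prod_unfold prod.collapse) blast
    moreover have "sdim (insert u \<alpha>) = sdim \<alpha> + 1"
      using step.hyps(3,4) by (simp add: sdim_def)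
    then have "\<forall>(\<gamma>, \<delta>)\<in>insert ?e M. \<gamma> \<in> K \<union> {\<alpha>, insert u \<alpha>} \<and> \<delta> \<in> K \<union> {\<alpha>, insert u \<alpha>} \<and>
        \<gamma> \<subseteq> \<delta> \<and> sdim \<delta> = sdim \<gamma> + 1"
      using step.IH by (simp add: subset_insertI) blast
    moreover have "Domain (insert ?e M) \<union> Range (insert ?e M) = K \<union> {\<alpha>, insert u \<alpha>}"
      unfolding step.IH[THEN conjunct2, THEN conjunct2, THEN conjunct1, symmetric] by auto
    moreover have "\<exists>v. ({}, {v}) \<in> insert ?e M"
      using step.IH[THEN conjunct2, THEN conjunct2, THEN conjunct2] by blast
    ultimately show ?case by (simp only: simp_thms)
  qed
  have rank: "\<exists>h. matching_rank K M h"
    using assms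
  proof (induction rule: expansion.induct)
    case (base u)
    have edge: "(x, y) = ({}, {u})" if "(x, y) \<in> (hasse {{}, {u}} - {({}, {u})}\<inverse>) \<union> {({}, {u})}" for x y
    proof (rule ccontr)
      assume "(x, y) \<noteq> ({}, {u})"
      then have h: "(x, y) \<in> hasse {{}, {u}}" "(y, x) \<noteq> ({}, {u})" using that by blast+
      then have "x \<in> {{}, {u}}" "y \<in> {{}, {u}}" "int (card x) = int (card y) + 1"
        by (simp_all add: hasse_def sdim_def)
      then have "x = {u}" "y = {}" by auto
      then show False using h by simp
    qed
    have "matching_rank {{}, {u}} {({}, {u})} (\<lambda>x. if x = {} then 1 else 0)"
    proof (rule matching_rankI)
      fix x y assume "(x, y) \<in> (hasse {{}, {u}} - {({}, {u})}\<inverse>) \<union> {({}, {u})}"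
      then have "(x, y) = ({}, {u})" by (rule edge)
      then show "(if y = {} then 1 else 0 :: nat) < (if x = {} then 1 else 0)" by simp
    qed
    then show ?case by blast
  next
    case (step K M \<alpha> u)
    then obtain h where h: "matching_rank K M h" by blast
    have K: "finite_complex K" using step.hyps(1) expansion_complex by blast
    define N where "N = Max (h ` K)"
    have N: "h x \<le> N" if "x \<in> K" for x
      using that K unfolding N_def finite_complex_def by simp
    \<comment> \<open>The matched edge runs upwards from \<open>\<alpha>\<close>, so
      \<open>\<alpha>\<close> ranks above \<open>insert u \<alpha>\<close>. Both exceed all old
      ranks, and no edge leads from \<open>K\<close> into the new pair, as \<open>K\<close> is
      closed under subsets.\<close>
    define h' where "h' = h(\<alpha> := N + 2, insert u \<alpha> := N + 1)"
    have MK: "x \<in> K \<and> y \<in> K" if "(x, y) \<in> M" for x y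
      using expansion_pair_mem[OF step.hyps(1) that] .
    have hK: "h' x = h x" if "x \<in> K" for x
      using that step.hyps(5,6) by (auto simp: h'_def)
    have h\<alpha>: "h' \<alpha> = N + 2" "h' (insert u \<alpha>) = N + 1"
      using step.hyps(4) by (auto simp: h'_def)
    let ?K = "K \<union> {\<alpha>, insert u \<alpha>}" and ?M = "insert (\<alpha>, insert u \<alpha>) M"
    have "h' y < h' x" if xy: "(x, y) \<in> (hasse ?K - ?M\<inverse>) \<union> ?M" for x y
    proof -
      consider "(x, y) \<in> M" | "(x, y) = (\<alpha>, insert u \<alpha>)"
        | "(x, y) \<in> hasse ?K" "(x, y) \<notin> ?M\<inverse>"
        using xy by blast
      then show ?thesis
      proof cases
        case 1
        then show ?thesis using MK[OF 1] hK matching_rankD[OF h UnI2[OF 1]] by simp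
      next
        case 2
        then show ?thesis using h\<alpha> by simp
      next
        case 3
        have mem: "x \<in> ?K" "y \<in> ?K" "y \<subseteq> x" "x \<noteq> y"
          using hasseD[OF 3(1)] by simp_all
        show ?thesis
        proof (cases "x \<in> K")
          case True
          then have "y \<in> K" using finite_complexD(3)[OF K] mem(3) by blast
          then have "(x, y) \<in> hasse K - M\<inverse>"
            using 3 True unfolding hasse_def by simp
          then show ?thesis using matching_rankD[OF h UnI1] True \<open>y \<in> K\<close> hK by simp
        next
          case False
          then have x: "x = \<alpha> \<or> x = insert u \<alpha>" using mem by blast
          have "y \<in> K"
          proof (rule ccontr)
            assume "y \<notin> K"
            then have "y = \<alpha> \<or> y = insert u \<alpha>" using mem by blast
            then have "y = \<alpha> \<and> x = insert u \<alpha>" using x mem(3,4) step.hyps(4) by blast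
            then show False using 3(2) by simp
          qed
          then show ?thesis using x h\<alpha> hK[of y] N[of y] by auto
        qed
      qed
    qed
    then have "matching_rank ?K ?M h'"
      by (rule matching_rankI)
    then show ?case by blast
  qed
  show "\<exists>h. matching_rank K M h" by (rule rank)
  then obtain h where "matching_rank K M h" by blast
  then have "acyclic ((hasse K - M\<inverse>) \<union> M)" by (rule matching_rank_acyclic)
  then show "acyclic_matching K M"
    using pairs unfolding acyclic_matching_def by (intro conjI) simp_all
  show "Domain M \<union> Range M = K" "\<exists>u. ({}, {u}) \<in> M" using pairs by auto
qed

text \<open>By maximality no edge of the diagram ends in a facet, so the facets can all share one
  rank above the others.\<close>

lemma acyclic_matching_add_facets:
  assumes X: "finite_complex X" and M: "expansion (X - F) M"
    and F: "\<And>\<sigma>. \<sigma> \<in> F \<Longrightarrow> maximal_simplex X \<sigma>"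
  shows "acyclic_matching X M"
proof -
  obtain h where h: "matching_rank (X - F) M h" using expansion_matching[OF M] by blast
  define N where "N = Max (h ` (X - F))"
  have N: "h x \<le> N" if "x \<in> X - F" for x
    using that X unfolding N_def finite_complex_def by simp
  define h' where "h' = (\<lambda>x. if x \<in> F then N + 1 else h x)"
  have am: "acyclic_matching (X - F) M" using expansion_matching[OF M] by blast
  have "h' y < h' x" if xy: "(x, y) \<in> (hasse X - M\<inverse>) \<union> M" for x y
  proof -
    consider "(x, y) \<in> M" | "(x, y) \<in> hasse X" "(x, y) \<notin> M\<inverse>" using xy by blast
    then show ?thesis
    proof cases
      case 1
      then have "x \<notin> F" "y \<notin> F" using expansion_pair_mem[OF M 1] by simp_all
      then show ?thesis using matching_rankD[OF h UnI2[OF 1]] by (simp add: h'_def)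
    next
      case 2
      have xy: "x \<in> X" "y \<in> X" "y \<subseteq> x" "x \<noteq> y" using hasseD[OF 2(1)] .
      then have y: "y \<notin> F" using F unfolding maximal_simplex_def by blast
      show ?thesis
      proof (cases "x \<in> F")
        case True
        then show ?thesis using y N[of y] xy by (simp add: h'_def)
      next
        case False
        then have "(x, y) \<in> hasse (X - F) - M\<inverse>" using 2 y xy by (simp add: hasse_def)
        then show ?thesis using matching_rankD[OF h UnI1] y False by (simp add: h'_def)
      qed
    qed
  qed
  then have "matching_rank X M h'" by (rule matching_rankI)
  then have "acyclic ((hasse X - M\<inverse>) \<union> M)" by (rule matching_rank_acyclic)
  moreover have "\<forall>(\<alpha>, \<beta>)\<in>M. \<alpha> \<in> X \<and> \<beta> \<in> X \<and> \<alpha> \<subseteq> \<beta> \<and> sdim \<beta> = sdim \<alpha> + 1"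
    using am[unfolded acyclic_matching_def, THEN conjunct1] by (simp add: split_beta)
  ultimately show ?thesis
    using am[unfolded acyclic_matching_def] unfolding acyclic_matching_def by (intro conjI) simp_all
qed

section \<open>Chains in a grid\<close>

definition grid_chains :: "('a \<Rightarrow> nat) \<Rightarrow> ('a \<Rightarrow> nat) \<Rightarrow> 'a set \<Rightarrow> 'a set set" where
  "grid_chains a b P = {S. S \<subseteq> P \<and> (\<forall>x\<in>S. \<forall>y\<in>S. x \<noteq> y \<longrightarrow>
     a x < a y \<and> b x < b y \<or> a y < a x \<and> b y < b x)}"

text \<open>Thresholds on a fixed \<open>V\<close> let the recursion change only \<open>p\<close>
  and \<open>q\<close>, while the hypothesis on nonempty cells is stated once for
  \<open>V\<close>.\<close>

definition region :: "('a \<Rightarrow> nat) \<Rightarrow> ('a \<Rightarrow> nat) \<Rightarrow> 'a set \<Rightarrow> nat \<Rightarrow> nat \<Rightarrow> 'a set" where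
  "region a b V p q = {x \<in> V. p \<le> a x \<and> q \<le> b x}"

lemma finite_complex_grid_chains: "finite P \<Longrightarrow> finite_complex (grid_chains a b P)"
proof (rule finite_complexI)
  assume P: "finite P"
  have "grid_chains a b P \<subseteq> Pow P" unfolding grid_chains_def by blast
  then show "finite (grid_chains a b P)" using P by (simp add: finite_subset)
  show "finite S" if "S \<in> grid_chains a b P" for S
    using that P unfolding grid_chains_def by (auto intro: finite_subset)
  show "T \<in> grid_chains a b P" if "S \<in> grid_chains a b P" "T \<subseteq> S" for S T
    using that by (simp add: grid_chains_def subset_iff)
qed

lemma empty_in_grid_chains: "{} \<in> grid_chains a b P"
  by (simp add: grid_chains_def)

lemma grid_chains_empty: "grid_chains a b {} = {{}}"
  by (auto simp: grid_chains_def)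

lemma grid_chains_mono: "P \<subseteq> Q \<Longrightarrow> grid_chains a b P \<subseteq> grid_chains a b Q"
  by (auto simp: grid_chains_def)

lemma grid_chains_subset: "S \<in> grid_chains a b P \<Longrightarrow> S \<subseteq> P"
  by (simp add: grid_chains_def)

lemma insert_grid_chain:
  assumes "r \<in> P" "S \<in> grid_chains a b (region a b P (Suc (a r)) (Suc (b r)))"
  shows "insert r S \<in> grid_chains a b P" "r \<notin> S"
proof -
  have S: "a r < a x \<and> b r < b x \<and> x \<in> P" if "x \<in> S" for x
    using that grid_chains_subset[OF assms(2)] unfolding region_def by auto
  then show "r \<notin> S" by blast
  show "insert r S \<in> grid_chains a b P"
    using assms S unfolding grid_chains_def by auto
qed

text \<open>An element of the first row or the first column of a region is a minimal element of
  the strict product order.\<close>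

lemma remove_grid_chain:
  assumes S: "S \<in> grid_chains a b (region a b V p q)" and r: "r \<in> S" "a r = p \<or> b r = q"
  shows "S - {r} \<in> grid_chains a b (region a b V (Suc (a r)) (Suc (b r)))"
proof -
  have "x \<in> region a b V (Suc (a r)) (Suc (b r))" if x: "x \<in> S - {r}" for x
  proof -
    have "x \<in> V" "p \<le> a x" "q \<le> b x"
      using x grid_chains_subset[OF S] unfolding region_def by auto
    moreover have "a x < a r \<and> b x < b r \<or> a r < a x \<and> b r < b x"
      using S x r(1) unfolding grid_chains_def by auto
    ultimately show ?thesis using r(2) unfolding region_def by auto
  qed
  then show ?thesis using S unfolding grid_chains_def by blast
qed

lemma insert_image_diff:
  assumes "r \<notin> \<Union>A"
  shows "insert r ` (A - B) = insert r ` A - insert r ` (A \<inter> B)"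
proof -
  have "inj_on (insert r) A"
    using assms by (intro inj_onI) (metis UnionI insert_ident)
  moreover have "insert r ` (A - B) = insert r ` (A - A \<inter> B)" by (rule arg_cong[where f = "image _"]) blast
  ultimately show ?thesis by (simp add: inj_on_image_set_diff)
qed

text \<open>The hypothesis \<open>cells\<close> says that the occupied cells are closed downwards,
  so every nonempty region has a vertex \<open>u\<close> in its corner cell. The cone with apex
  \<open>u\<close> over the chains of \<open>Q\<close> is built first; then each \<open>r\<close> in
  \<open>R\<close> is attached along its link \<open>Lk r\<close>, minus the facets that the
  recursion leaves unmatched there.\<close>

lemma grid_chains_expansion:
  fixes a b :: "'a \<Rightarrow> nat"
  assumes V: "finite V"
    and cells: "\<And>x p q. x \<in> V \<Longrightarrow> p \<le> a x \<Longrightarrow> q \<le> b x \<Longrightarrow> \<exists>u\<in>V. a u = p \<and> b u = q"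
    and ne: "region a b V p q \<noteq> {}"
  shows "\<exists>M F. expansion (grid_chains a b (region a b V p q) - F) M \<and>
    (\<forall>\<sigma>\<in>F. maximal_simplex (grid_chains a b (region a b V p q)) \<sigma>)"
  using ne
proof (induction "card (region a b V p q)" arbitrary: p q rule: less_induct)
  case less
  define P where "P = region a b V p q"
  define Q where "Q = region a b V (Suc p) (Suc q)"
  have fin: "finite P" "finite Q" using V by (simp_all add: P_def Q_def region_def)
  obtain x where "x \<in> V" "p \<le> a x" "q \<le> b x"
    using less.prems by (auto simp: region_def)
  then obtain u where u: "u \<in> V" "a u = p" "b u = q"
    using cells by blast
  \<comment> \<open>The other vertices of the corner cell belong to \<open>R\<close> as well; their
    link is the same as that of \<open>u\<close>.\<close>
  define R where "R = {x \<in> P. (a x = p \<or> b x = q) \<and> x \<noteq> u}"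
  define Lk where "Lk r = grid_chains a b (region a b V (Suc (a r)) (Suc (b r)))" for r
  have Lk_Q: "Lk r \<subseteq> grid_chains a b Q" if "r \<in> P" for r
    unfolding Lk_def Q_def by (rule grid_chains_mono) (use that in \<open>auto simp: P_def region_def\<close>)
  have Lk_reg: "region a b P (Suc (a r)) (Suc (b r)) = region a b V (Suc (a r)) (Suc (b r))"
    if "r \<in> P" for r
    using that unfolding P_def region_def by auto
  have ins: "insert r S \<in> grid_chains a b P" "r \<notin> S" if "r \<in> P" "S \<in> Lk r" for r S
    using insert_grid_chain[of r P S a b] that unfolding Lk_def by (simp_all add: Lk_reg)
  have rem: "S - {r} \<in> Lk r" if "S \<in> grid_chains a b P" "r \<in> S" "a r = p \<or> b r = q" for S r
    using remove_grid_chain[of S a b V p q r] that unfolding Lk_def P_def by blast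
  \<comment> \<open>The chains through \<open>r\<close> are exactly \<open>r\<close> joined to the
    chains in \<open>Lk r\<close>, so maximality passes from the link to the whole complex.\<close>
  have maxi: "maximal_simplex (grid_chains a b P) (insert r \<tau>)"
    if "r \<in> R" "maximal_simplex (Lk r) \<tau>" for r \<tau>
    unfolding maximal_simplex_def
  proof (intro conjI ballI impI)
    have r: "r \<in> P" "a r = p \<or> b r = q" using that(1) by (auto simp: R_def)
    have \<tau>: "\<tau> \<in> Lk r" using that(2) by (simp add: maximal_simplex_def)
    show "insert r \<tau> \<in> grid_chains a b P" using ins(1)[OF r(1) \<tau>] .
    fix S assume S: "S \<in> grid_chains a b P" "insert r \<tau> \<subseteq> S"
    then have "S - {r} \<in> Lk r" using rem r by blast
    moreover have "\<tau> \<subseteq> S - {r}" using S ins(2)[OF r(1) \<tau>] by blast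
    ultimately have "S - {r} = \<tau>" using that(2) by (simp add: maximal_simplex_def)
    then show "S = insert r \<tau>" using S by blast
  qed
  have uQ: "u \<notin> Q" and uP: "u \<in> P" using u by (simp_all add: Q_def P_def region_def)
  have RQ: "R \<inter> Q = {}" by (auto simp: R_def Q_def region_def)
  have QP: "Q \<subseteq> P" by (auto simp: P_def Q_def region_def)
  have Lk_u: "Lk u = grid_chains a b Q" by (simp add: Lk_def Q_def u)
  have "\<exists>M. expansion (grid_chains a b Q \<union> insert u ` grid_chains a b Q) M"
    using uQ grid_chains_subset[of _ a b Q] finite_complex_grid_chains[OF fin(2), of a b]
    by (intro expansion_cone) (auto simp: empty_in_grid_chains)
  then obtain M0 where M0: "expansion (grid_chains a b Q \<union> insert u ` grid_chains a b Q) M0" by blast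
  define C where "C R' = grid_chains a b Q \<union> insert u ` grid_chains a b Q \<union> (\<Union>r\<in>R'. insert r ` Lk r)" for R'
  \<comment> \<open>The inclusion for \<open>F\<close> is part of the induction because it shows
    that every deleted facet contains an element of \<open>R\<close>; the links, which lie in
    \<open>Q\<close>, are thus untouched by the deletions.\<close>
  have steps: "\<exists>M F. expansion (C R' - F) M \<and> F \<subseteq> (\<Union>r\<in>R'. insert r ` Lk r) \<and>
      (\<forall>\<sigma>\<in>F. maximal_simplex (grid_chains a b P) \<sigma>)" if "finite R'" "R' \<subseteq> R" for R'
    using that
  proof (induction R' rule: finite_induct)
    case empty
    have "expansion (C {} - {}) M0" using M0 by (simp add: C_def)
    then show ?case by blast
  next
    case (insert r R')
    then obtain M F where M: "expansion (C R' - F) M" and F: "F \<subseteq> (\<Union>r\<in>R'. insert r ` Lk r)"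
      and Fmax: "\<And>\<sigma>. \<sigma> \<in> F \<Longrightarrow> maximal_simplex (grid_chains a b P) \<sigma>" by blast
    have r: "r \<in> R" "r \<in> P" using insert.prems by (auto simp: R_def)
    have "r \<notin> S" if "S \<in> C R'" for S
    proof -
      have "S \<subseteq> Q \<union> {u} \<union> R'"
        using that Lk_Q insert.prems grid_chains_subset[of _ a b Q] unfolding C_def R_def by blast
      then show ?thesis using r(1) RQ insert.hyps(2) by (auto simp: R_def)
    qed
    then have rC: "r \<notin> \<Union>(C R')" by blast
    have FC: "F \<subseteq> C R'" using F by (auto simp: C_def)
    have C_insert: "C (insert r R') = C R' \<union> insert r ` Lk r" by (auto simp: C_def)
    have rLk: "r \<notin> \<Union>(Lk r)" using ins(2)[OF r(2)] by blast
    show ?case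
    proof (cases "region a b V (Suc (a r)) (Suc (b r)) = {}")
      \<comment> \<open>Here the link has no vertex with which the empty simplex could be paired.
        The isolated vertex \<open>{r}\<close> is itself a facet and stays unmatched.\<close>
      case True
      then have Lk: "Lk r = {{}}" by (simp add: Lk_def grid_chains_empty)
      have "{r} \<notin> C R'" using rC by blast
      then have "C (insert r R') - insert {r} F = C R' - F"
        unfolding C_insert Lk by auto
      moreover have "maximal_simplex (grid_chains a b P) {r}"
        using maxi[OF r(1), of "{}"] Lk by (simp add: maximal_simplex_def)
      ultimately have "expansion (C (insert r R') - insert {r} F) M"
        "\<forall>\<sigma>\<in>insert {r} F. maximal_simplex (grid_chains a b P) \<sigma>"
        using M Fmax by auto
      moreover have "insert {r} F \<subseteq> (\<Union>r\<in>insert r R'. insert r ` Lk r)"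
        using F Lk by auto
      ultimately show ?thesis by blast
    next
      case False
      have "region a b V (Suc (a r)) (Suc (b r)) \<subset> P"
      proof
        show "region a b V (Suc (a r)) (Suc (b r)) \<subseteq> P"
          using r(2) by (auto simp: P_def region_def)
        have "r \<notin> region a b V (Suc (a r)) (Suc (b r))" by (simp add: region_def)
        then show "region a b V (Suc (a r)) (Suc (b r)) \<noteq> P" using r(2) by blast
      qed
      then have "card (region a b V (Suc (a r)) (Suc (b r))) < card (region a b V p q)"
        using fin(1) unfolding P_def by (rule psubset_card_mono[rotated])
      then obtain N F' where N: "expansion (Lk r - F') N"
        and F': "\<And>\<sigma>. \<sigma> \<in> F' \<Longrightarrow> maximal_simplex (Lk r) \<sigma>"
        using less.hyps[of "Suc (a r)" "Suc (b r)"] False unfolding Lk_def by blast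
      have F'_Lk: "F' \<subseteq> Lk r" using F' by (auto simp: maximal_simplex_def)
      have "Lk r \<inter> F = {}"
      proof -
        have "S \<inter> R \<noteq> {}" if "S \<in> F" for S using that F insert.prems by blast
        moreover have "S \<inter> R = {}" if "S \<in> Lk r" for S
          using that Lk_Q[OF r(2)] grid_chains_subset[of S a b Q] RQ by blast
        ultimately show ?thesis by blast
      qed
      then have sub: "Lk r - F' \<subseteq> C R' - F"
        using Lk_Q[OF r(2)] by (auto simp: C_def)
      have new: "r \<notin> \<Union>(C R' - F)" using rC by blast
      obtain M' where M': "expansion ((C R' - F) \<union> insert r ` (Lk r - F')) M'"
        using expansion_add_cone[OF N M sub new] ..
      have set_eq: "(A - D) \<union> (B - E) = (A \<union> B) - (D \<union> E)"
        if "D \<subseteq> A" "A \<inter> B = {}" "E \<subseteq> B" for A B D E :: "'a set set"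
        using that by blast
      have "insert r ` (Lk r - F') = insert r ` Lk r - insert r ` F'"
        using insert_image_diff[OF rLk, of F'] F'_Lk by (simp add: Int_absorb1)
      moreover have "C R' \<inter> insert r ` Lk r = {}" using rC by blast
      ultimately have "(C R' - F) \<union> insert r ` (Lk r - F') =
          C (insert r R') - (F \<union> insert r ` F')"
        using set_eq[OF FC _ image_mono[OF F'_Lk], of "insert r"] by (simp only: C_insert)
      then have "expansion (C (insert r R') - (F \<union> insert r ` F')) M'" using M' by (simp only:)
      moreover have "F \<union> insert r ` F' \<subseteq> (\<Union>r\<in>insert r R'. insert r ` Lk r)"
        using F F'_Lk by blast
      moreover have "\<forall>\<sigma>\<in>F \<union> insert r ` F'. maximal_simplex (grid_chains a b P) \<sigma>"
        using Fmax maxi[OF r(1) F'] by blast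
      ultimately show ?thesis by blast
    qed
  qed
  have "finite R" using fin(1) unfolding R_def by simp
  from steps[OF this subset_refl]
  obtain M F where "expansion (C R - F) M" "\<forall>\<sigma>\<in>F. maximal_simplex (grid_chains a b P) \<sigma>"
    by (elim exE conjE)
  moreover have "C R = grid_chains a b P"
  proof
    have "insert u S \<in> grid_chains a b P" if "S \<in> grid_chains a b Q" for S
      using ins(1)[OF uP] that Lk_u by blast
    moreover have "insert r S \<in> grid_chains a b P" if "S \<in> Lk r" "r \<in> R" for r S
      using ins(1) that by (auto simp: R_def)
    ultimately show "C R \<subseteq> grid_chains a b P"
      unfolding C_def using grid_chains_mono[OF QP] by blast
    show "grid_chains a b P \<subseteq> C R"
    proof
      fix S assume S: "S \<in> grid_chains a b P"
      have split: "S \<in> insert r ` A" if "r \<in> S" "S - {r} \<in> A" for r A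
        using that insert_Diff[OF that(1), symmetric] by (intro image_eqI[of _ _ "S - {r}"])
      consider r where "r \<in> S" "r \<in> R" | "u \<in> S" | "S \<inter> R = {}" "u \<notin> S" by blast
      then show "S \<in> C R"
      proof cases
        case 1
        then have "S - {r} \<in> Lk r" using rem[OF S 1(1)] by (simp add: R_def)
        then have "S \<in> insert r ` Lk r" by (rule split[OF 1(1)])
        then show ?thesis using 1(2) unfolding C_def by blast
      next
        case 2
        have "S - {u} \<in> grid_chains a b Q" using rem[OF S 2] u Lk_u by simp
        then have "S \<in> insert u ` grid_chains a b Q" by (rule split[OF 2])
        then show ?thesis unfolding C_def by blast
      next
        case 3
        have "S \<subseteq> Q"
        proof
          fix x assume x: "x \<in> S"
          then have xP: "x \<in> P" using grid_chains_subset[OF S] by blast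
          moreover have "a x \<noteq> p" "b x \<noteq> q" using x xP 3 by (auto simp: R_def)
          ultimately show "x \<in> Q" by (auto simp: P_def Q_def region_def)
        qed
        then have "S \<in> grid_chains a b Q" using S unfolding grid_chains_def by blast
        then show ?thesis unfolding C_def by blast
      qed
    qed
  qed
  ultimately show ?case unfolding P_def by metis
qed

section \<open>Collapses of geometric realizations\<close>

definition realization :: "'a set set \<Rightarrow> ('a \<Rightarrow> real) set" where
  "realization X = {x. (\<forall>v. 0 \<le> x v) \<and> {v. x v \<noteq> 0} \<in> X \<and> (\<Sum>v | x v \<noteq> 0. x v) = 1}"

lemma geometric_realization_eq: "geometric_realization X = top_of_set (realization X)"
  by (simp add: geometric_realization_def realization_def euclidean_product_topology)

lemma realizationI:
  assumes X: "finite_complex X" and \<sigma>: "\<sigma> \<in> X" and "\<And>v. v \<in> \<sigma> \<Longrightarrow> 0 \<le> x v"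
    and 0: "\<And>v. v \<notin> \<sigma> \<Longrightarrow> x v = 0" and sum: "sum x \<sigma> = 1"
  shows "x \<in> realization X"
proof -
  have sub: "{v. x v \<noteq> 0} \<subseteq> \<sigma>" using 0 by auto
  then have "{v. x v \<noteq> 0} \<in> X" using finite_complexD(3)[OF X \<sigma>] by blast
  moreover have "(\<Sum>v | x v \<noteq> 0. x v) = sum x \<sigma>"
    using sub finite_complexD(2)[OF X \<sigma>] by (intro sum.mono_neutral_left) auto
  moreover have "0 \<le> x v" for v using assms(3)[of v] 0[of v] by fastforce
  ultimately show ?thesis using sum by (simp add: realization_def)
qed

lemma realizationD:
  assumes "x \<in> realization X"
  shows "0 \<le> x v" "{v. x v \<noteq> 0} \<in> X" "(\<Sum>v | x v \<noteq> 0. x v) = 1"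
  using assms by (simp_all add: realization_def)

lemma realization_sum:
  assumes "x \<in> realization X" "finite \<sigma>" "{v. x v \<noteq> 0} \<subseteq> \<sigma>"
  shows "sum x \<sigma> = 1"
proof -
  have "(\<Sum>v | x v \<noteq> 0. x v) = sum x \<sigma>"
    using assms by (intro sum.mono_neutral_left) auto
  then show ?thesis using realizationD(3)[OF assms(1)] by simp
qed

text \<open>It is continuous on the whole realization and positive exactly where the support
  contains \<open>\<sigma>\<close>. For a facet this is its open cell, so deformations built from it
  need no case distinction on supports.\<close>

definition mincoord :: "'a set \<Rightarrow> ('a \<Rightarrow> real) \<Rightarrow> real" where
  "mincoord \<sigma> x = Min (x ` \<sigma>)"

lemma mincoord_le: "finite \<sigma> \<Longrightarrow> v \<in> \<sigma> \<Longrightarrow> mincoord \<sigma> x \<le> x v"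
  by (simp add: mincoord_def)

lemma mincoord_attained:
  assumes "finite \<sigma>" "\<sigma> \<noteq> {}"
  obtains v where "v \<in> \<sigma>" "x v = mincoord \<sigma> x"
proof -
  have "mincoord \<sigma> x \<in> x ` \<sigma>" unfolding mincoord_def using assms by (intro Min_in) auto
  then show ?thesis using that by (metis imageE)
qed

lemma continuous_on_mincoord:
  assumes "finite \<sigma>" "\<sigma> \<noteq> {}" "continuous_on S f"
  shows "continuous_on S (\<lambda>p. mincoord \<sigma> (f p))"
  using assms(1,2)
proof (induction rule: finite_ne_induct)
  case (singleton v)
  then show ?case
    using continuous_on_product_then_coordinatewise[OF assms(3)] by (simp add: mincoord_def)
next
  case (insert v \<sigma>)
  then have eq: "(\<lambda>p. mincoord (insert v \<sigma>) (f p)) = (\<lambda>p. min (f p v) (mincoord \<sigma> (f p)))"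
    by (simp add: mincoord_def)
  show ?case
    unfolding eq
    by (intro continuous_on_min insert.IH continuous_on_product_then_coordinatewise[OF assms(3)])
qed

lemma mincoord_pos_iff:
  assumes x: "x \<in> realization X" and \<sigma>: "finite \<sigma>" "\<sigma> \<noteq> {}"
  shows "mincoord \<sigma> x \<ge> 0" "mincoord \<sigma> x > 0 \<longleftrightarrow> \<sigma> \<subseteq> {v. x v \<noteq> 0}"
proof -
  obtain w where w: "w \<in> \<sigma>" "x w = mincoord \<sigma> x" using mincoord_attained[OF \<sigma>] .
  show "mincoord \<sigma> x \<ge> 0" using realizationD(1)[OF x, of w] w by simp
  have "x v \<noteq> 0" if "mincoord \<sigma> x > 0" "v \<in> \<sigma>" for v
    using mincoord_le[OF \<sigma>(1) that(2), of x] that(1) by simp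
  moreover have "mincoord \<sigma> x > 0" if "\<sigma> \<subseteq> {v. x v \<noteq> 0}"
    using that w \<open>mincoord \<sigma> x \<ge> 0\<close> by auto
  ultimately show "mincoord \<sigma> x > 0 \<longleftrightarrow> \<sigma> \<subseteq> {v. x v \<noteq> 0}" by blast
qed

section \<open>Elementary collapses as deformation retractions\<close>

text \<open>The weight common to all vertices of \<open>\<alpha>\<close> is moved to
  \<open>u\<close>. Where the support contains \<open>\<alpha>\<close>, the hypothesis
  \<open>cone\<close> allows \<open>u\<close> to be added to it, and at time 1 some vertex of
  \<open>\<alpha>\<close> has lost its weight. Elsewhere the common weight is 0 and nothing
  moves.\<close>

lemma collapse_homotopy_equivalent:
  assumes K: "finite_complex K" and \<alpha>: "finite \<alpha>" "\<alpha> \<noteq> {}" "u \<notin> \<alpha>"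
    and cone: "\<And>S. S \<in> K \<Longrightarrow> \<alpha> \<subseteq> S \<Longrightarrow> insert u S \<in> K"
  shows "geometric_realization K homotopy_equivalent_space geometric_realization {S \<in> K. \<not> \<alpha> \<subseteq> S}"
proof -
  define K' where "K' = {S \<in> K. \<not> \<alpha> \<subseteq> S}"
  \<comment> \<open>The direction of motion; its entries sum to 0 over any finite set containing
    \<open>insert u \<alpha>\<close>, so the total weight stays 1.\<close>
  define d where "d v = (if v = u then real (card \<alpha>) else if v \<in> \<alpha> then - 1 else 0)" for v
  define f where "f = (\<lambda>(s, x) v. x v + s * mincoord \<alpha> x * d v)"
  have sum_d: "sum d T = 0" if "insert u \<alpha> \<subseteq> T" "finite T" for T
  proof -
    have "sum d T = sum d (insert u \<alpha>)"
      using that by (intro sum.mono_neutral_right) (auto simp: d_def)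
    also have "\<dots> = d u + sum d \<alpha>" using \<alpha> by simp
    also have "sum d \<alpha> = (\<Sum>v\<in>\<alpha>. - 1)" using \<alpha>(3) by (intro sum.cong) (auto simp: d_def)
    finally show ?thesis by (simp add: d_def)
  qed
  have f_in: "f (s, x) \<in> realization K" if s: "s \<in> {0..1}" and x: "x \<in> realization K" for s x
  proof (cases "mincoord \<alpha> x = 0")
    case True
    then have "f (s, x) = x" by (simp add: f_def)
    then show ?thesis using x by simp
  next
    case False
    then have pos: "mincoord \<alpha> x > 0" and sub: "\<alpha> \<subseteq> {v. x v \<noteq> 0}"
      using mincoord_pos_iff[OF x \<alpha>(1,2)] by linarith+
    define S where "S = insert u {v. x v \<noteq> 0}"
    have S: "S \<in> K" using cone[OF realizationD(2)[OF x] sub] by (simp add: S_def)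
    have fin: "finite S" using finite_complexD(2)[OF K S] .
    have "0 \<le> f (s, x) v" for v
    proof -
      have "s * mincoord \<alpha> x \<le> mincoord \<alpha> x" using s pos by (simp add: mult_left_le_one_le)
      moreover have "mincoord \<alpha> x \<le> x v" if "v \<in> \<alpha>" using mincoord_le[OF \<alpha>(1) that] .
      moreover have "0 \<le> s * mincoord \<alpha> x * real (card \<alpha>)" using s pos by simp
      ultimately show ?thesis
        using realizationD(1)[OF x, of v] unfolding f_def d_def by auto
    qed
    moreover have "f (s, x) v = 0" if "v \<notin> S" for v
      using that sub unfolding f_def d_def S_def by auto
    moreover have "sum (f (s, x)) S = 1"
    proof -
      have "sum (f (s, x)) S = sum x S + s * mincoord \<alpha> x * sum d S"
        by (simp add: f_def sum.distrib sum_distrib_left)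
      also have "sum d S = 0" using sub fin by (intro sum_d) (auto simp: S_def)
      also have "sum x S = 1" using x fin by (rule realization_sum) (auto simp: S_def)
      finally show ?thesis by simp
    qed
    ultimately show ?thesis using S by (intro realizationI[OF K S]) auto
  qed
  have r_in: "f (1, x) \<in> realization K'" if x: "x \<in> realization K" for x
  proof -
    have fx: "f (1, x) \<in> realization K" using f_in[of 1 x] x by simp
    obtain w where w: "w \<in> \<alpha>" "x w = mincoord \<alpha> x" using mincoord_attained[OF \<alpha>(1,2)] .
    then have "f (1, x) w = 0" using \<alpha>(3) by (auto simp: f_def d_def)
    then show ?thesis using fx w(1) by (auto simp: realization_def K'_def)
  qed
  have fixed: "f (s, x) = x" if x: "x \<in> realization K'" for s x
  proof -
    have "\<not> \<alpha> \<subseteq> {v. x v \<noteq> 0}" using realizationD(2)[OF x] by (simp add: K'_def)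
    then have "mincoord \<alpha> x = 0"
      using mincoord_pos_iff[OF x \<alpha>(1,2)] by linarith
    then show ?thesis by (simp add: f_def)
  qed
  have K'K: "realization K' \<subseteq> realization K" by (auto simp: realization_def K'_def)
  have cont: "continuous_on ({0..1} \<times> realization K) f"
    unfolding f_def case_prod_unfold
    by (intro continuous_intros continuous_on_mincoord \<alpha> continuous_on_snd
        continuous_on_product_then_coordinatewise[of _ snd])
  have "homotopic_with (\<lambda>_. True) (top_of_set (realization K)) (top_of_set (realization K))
      id (\<lambda>x. f (1, x))"
    unfolding homotopic_with_def
  proof (intro exI conjI)
    show "continuous_map (prod_topology (top_of_set {0..1}) (top_of_set (realization K)))
        (top_of_set (realization K)) f"
      using cont f_in by (auto simp: image_subset_iff)
  qed (auto simp: f_def)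
  then have "homotopic_with (\<lambda>_. True) (top_of_set (realization K)) (top_of_set (realization K))
      (\<lambda>x. f (1, x)) id"
    by (rule homotopic_with_symD)
  moreover have "retraction_maps (top_of_set (realization K)) (top_of_set (realization K'))
      (\<lambda>x. f (1, x)) id"
  proof -
    have "continuous_on (realization K) (\<lambda>x. f (1, x))"
      by (rule continuous_on_compose2[OF cont]) (auto intro!: continuous_intros)
    then show ?thesis
      using r_in fixed K'K unfolding retraction_maps_def by (auto simp: image_subset_iff)
  qed
  ultimately show ?thesis
    unfolding geometric_realization_eq K'_def
    by (rule deformation_retract_imp_homotopy_equivalent_space)
qed

lemma expansion_contractible:
  assumes "expansion K M"
  shows "contractible_space (geometric_realization K)"
  using assms
proof (induction rule: expansion.induct)
  case (base u)
  have "realization {{}, {u}} = {\<lambda>v. if v = u then 1 else 0}"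
  proof (intro set_eqI iffI)
    fix x assume x: "x \<in> realization {{}, {u}}"
    have "{v. x v \<noteq> 0} \<noteq> {}" using realizationD(3)[OF x] by force
    then have "{v. x v \<noteq> 0} = {u}" using realizationD(2)[OF x] by blast
    then have "x v = (if v = u then 1 else 0)" for v
      using realizationD(3)[OF x] by (cases "v = u") auto
    then show "x \<in> {\<lambda>v. if v = u then 1 else 0}" by blast
  qed (auto simp: realization_def)
  then show ?case
    by (simp add: geometric_realization_eq)
next
  case (step K M \<alpha> u)
  have "finite_complex K" using step.hyps(1) by (rule expansion_complex)
  \<comment> \<open>As \<open>K\<close> is closed under subsets and lacks \<open>\<alpha>\<close>,
    only the two new simplices contain \<open>\<alpha>\<close>; deleting them gives back
    \<open>K\<close>.\<close>
  then have notin: "\<not> \<alpha> \<subseteq> S" if "S \<in> K" for S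
    using finite_complexD(3) that step.hyps(5) by blast
  have "expansion (K \<union> {\<alpha>, insert u \<alpha>}) (insert (\<alpha>, insert u \<alpha>) M)"
    using step.hyps by (rule expansion.step)
  then have "finite_complex (K \<union> {\<alpha>, insert u \<alpha>})" by (rule expansion_complex)
  moreover have "insert u S \<in> K \<union> {\<alpha>, insert u \<alpha>}"
    if "S \<in> K \<union> {\<alpha>, insert u \<alpha>}" "\<alpha> \<subseteq> S" for S
    using that notin by auto
  ultimately have "geometric_realization (K \<union> {\<alpha>, insert u \<alpha>}) homotopy_equivalent_space
      geometric_realization {S \<in> K \<union> {\<alpha>, insert u \<alpha>}. \<not> \<alpha> \<subseteq> S}"
    using step.hyps(2-4) by (intro collapse_homotopy_equivalent)
  moreover have "{S \<in> K \<union> {\<alpha>, insert u \<alpha>}. \<not> \<alpha> \<subseteq> S} = K"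
    using notin by auto
  ultimately show ?case
    using step.IH homotopy_equivalent_space_contractibility by metis
qed

section \<open>Extending a contraction over facets\<close>

lemma finite_complex_remove_facets:
  assumes X: "finite_complex X" and F: "\<And>\<sigma>. \<sigma> \<in> F \<Longrightarrow> maximal_simplex X \<sigma>"
  shows "finite_complex (X - F)"
proof (rule finite_complexI)
  show "finite (X - F)" "\<And>S. S \<in> X - F \<Longrightarrow> finite S" using finite_complexD[OF X] by auto
  fix S T assume S: "S \<in> X - F" "T \<subseteq> S"
  then have "T \<in> X" using finite_complexD(3)[OF X, of S T] by blast
  moreover have "T \<notin> F" using F[of T] S unfolding maximal_simplex_def by blast
  ultimately show "T \<in> X - F" by blast
qed

text \<open>A support that contains a facet equals it, so at most one facet has a positive least
  coordinate at a given point. This reduces the sums over \<open>F\<close> in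
  \<open>facet_homotopy_extension\<close> to a single term.\<close>

lemma facet_support_cases:
  assumes X: "finite_complex X" and F: "\<And>\<sigma>. \<sigma> \<in> F \<Longrightarrow> maximal_simplex X \<sigma> \<and> \<sigma> \<noteq> {}"
    and x: "x \<in> realization X"
  obtains
    (inside) "x \<in> realization (X - F)" "\<And>\<tau>. \<tau> \<in> F \<Longrightarrow> mincoord \<tau> x = 0"
  | (facet) \<sigma> where "\<sigma> \<in> F" "{v. x v \<noteq> 0} = \<sigma>" "mincoord \<sigma> x > 0"
      "\<And>\<tau>. \<tau> \<in> F \<Longrightarrow> \<tau> \<noteq> \<sigma> \<Longrightarrow> mincoord \<tau> x = 0"
proof -
  have fin: "finite \<tau>" "\<tau> \<noteq> {}" "maximal_simplex X \<tau>" if "\<tau> \<in> F" for \<tau>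
    using F[OF that] finite_complexD(2)[OF X] by (auto simp: maximal_simplex_def)
  have zero: "mincoord \<tau> x = 0" if "\<tau> \<in> F" "\<tau> \<noteq> {v. x v \<noteq> 0}" for \<tau>
  proof -
    have "\<not> \<tau> \<subseteq> {v. x v \<noteq> 0}"
      using fin(3)[OF that(1)] realizationD(2)[OF x] that(2) unfolding maximal_simplex_def by blast
    then show ?thesis using mincoord_pos_iff[OF x fin(1,2)[OF that(1)]] by linarith
  qed
  show thesis
  proof (cases "{v. x v \<noteq> 0} \<in> F")
    case True
    then have "mincoord {v. x v \<noteq> 0} x > 0" using mincoord_pos_iff[OF x fin(1,2)[OF True]] by blast
    then show ?thesis using facet[OF True refl] zero by blast
  next
    case False
    then have "x \<in> realization (X - F)" using x by (simp add: realization_def)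
    moreover have "mincoord \<tau> x = 0" if "\<tau> \<in> F" for \<tau> using zero[OF that] that False by blast
    ultimately show ?thesis using inside by blast
  qed
qed

text \<open>The homotopy first dilates each facet from its barycenter, so that a growing collar of
  the boundary is pushed onto the boundary, and then contracts the image of the collar inside the
  remaining complex.\<close>

lemma facet_homotopy_extension:
  assumes X: "finite_complex X" and F: "\<And>\<sigma>. \<sigma> \<in> F \<Longrightarrow> maximal_simplex X \<sigma> \<and> \<sigma> \<noteq> {}"
    and contr: "contractible_space (geometric_realization (X - F))"
    and ne: "realization (X - F) \<noteq> {}"
  obtains H p where
    "continuous_on ({0..1::real} \<times> realization X) H"
    "\<And>t x. t \<in> {0..1::real} \<Longrightarrow> x \<in> realization X \<Longrightarrow> H (t, x) \<in> realization X"
    "\<And>x. x \<in> realization X \<Longrightarrow> H (0, x) = x"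
    "\<And>t x. t \<in> {0..1::real} \<Longrightarrow> x \<in> realization (X - F) \<Longrightarrow> H (t, x) \<in> realization (X - F)"
    "\<And>x. x \<in> realization (X - F) \<Longrightarrow> H (1, x) = p"
    "p \<in> realization (X - F)"
proof -
  define K where "K = X - F"
  have K: "finite_complex K" unfolding K_def using F by (intro finite_complex_remove_facets[OF X]) blast
  have fin: "finite \<tau>" "\<tau> \<noteq> {}" "maximal_simplex X \<tau>" "\<tau> \<in> X" if "\<tau> \<in> F" for \<tau>
    using F[OF that] finite_complexD(2)[OF X] by (auto simp: maximal_simplex_def)
  have "F \<subseteq> X" using fin(4) by blast
  then have finF: "finite F" using finite_complexD(1)[OF X] finite_subset by blast
  obtain p where "homotopic_with (\<lambda>_. True) (top_of_set (realization K)) (top_of_set (realization K))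
      id (\<lambda>x. p)"
    using contr unfolding contractible_space_def geometric_realization_eq K_def by blast
  then obtain G where G: "continuous_map (prod_topology (top_of_set {0..1::real}) (top_of_set (realization K)))
        (top_of_set (realization K)) G"
    and G0': "\<forall>x. G (0, x) = id x" and G1': "\<forall>x. G (1, x) = p"
    unfolding homotopic_with_def by blast
  have contG: "continuous_on ({0..1::real} \<times> realization K) G"
    and "G \<in> {0..1::real} \<times> realization K \<rightarrow> realization K"
    using G by simp_all
  then have GK: "\<And>t x. t \<in> {0..1::real} \<Longrightarrow> x \<in> realization K \<Longrightarrow> G (t, x) \<in> realization K"
    by blast
  have G0: "G (0, x) = x" and G1: "G (1, x) = p" for x
    using G0' G1' by simp_all
  \<comment> \<open>The weight of the barycenter of \<open>\<sigma>\<close> in \<open>x\<close>: 1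
    at the barycenter, 0 on the boundary. The sum \<open>cc\<close> selects the facet carrying
    \<open>x\<close> and vanishes on the remaining complex.\<close>
  define c where "c \<sigma> x = real (card \<sigma>) * mincoord \<sigma> x" for \<sigma> and x :: "'a \<Rightarrow> real"
  define cc where "cc x = (\<Sum>\<sigma>\<in>F. c \<sigma> x)" for x
  \<comment> \<open>What is left of \<open>x\<close> without its barycenter part. On a facet it has
    total weight \<open>1 - cc x\<close> and some vanishing coordinate; rescaled to total weight 1,
    it is the radial projection to the boundary.\<close>
  define z where "z x v = x v - (\<Sum>\<sigma>\<in>F. if v \<in> \<sigma> then mincoord \<sigma> x else 0)" for x and v
  \<comment> \<open>The dilation replaces the barycenter weight \<open>c\<close> by
    \<open>(2 * c - t) / (2 - t)\<close>: unchanged at time 0, always 1 at the barycenter, and 0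
    where \<open>2 * c = t\<close>. The \<open>max\<close> discards the facets that do not carry
    \<open>x\<close>, for which \<open>c\<close> is 0.\<close>
  define A where "A = (\<lambda>(t, x) v. 2 / (2 - t) * z x v +
    (\<Sum>\<sigma>\<in>F. if v \<in> \<sigma> then max 0 (2 * c \<sigma> x - t) / ((2 - t) * real (card \<sigma>)) else 0))"
  \<comment> \<open>In the collar \<open>2 * cc x \<le> t\<close> the point sits on the boundary and
    is contracted there, with the clock starting at 0 on the moving edge, where \<open>B\<close>
    meets \<open>A\<close>. The factor 2 confines the collar to \<open>cc x \<le> 1/2\<close>, away
    from the barycenter. In a facet with a single vertex \<open>cc\<close> is 1, so that vertex
    never moves.\<close>
  define B where "B = (\<lambda>(t, x). G (t - 2 * cc x, \<lambda>v. z x v / (1 - cc x)))"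
  define H where "H = (\<lambda>q. if 2 * cc (snd q) - fst q \<le> 0 then B q else A q)"
  have inside: "cc x = 0" "z x = x" if "\<And>\<tau>. \<tau> \<in> F \<Longrightarrow> mincoord \<tau> x = 0" for x
  proof -
    show "cc x = 0" using that by (simp add: cc_def c_def)
    have "(\<Sum>\<sigma>\<in>F. if v \<in> \<sigma> then mincoord \<sigma> x else 0) = 0" for v
      using that by (intro sum.neutral) auto
    then show "z x = x" by (simp add: z_def fun_eq_iff)
  qed
  have facet: "cc x = c \<sigma> x" "z x v = x v - (if v \<in> \<sigma> then mincoord \<sigma> x else 0)"
    "t \<ge> 0 \<Longrightarrow> A (t, x) v = 2 / (2 - t) * z x v +
       (if v \<in> \<sigma> then max 0 (2 * c \<sigma> x - t) / ((2 - t) * real (card \<sigma>)) else 0)"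
    if "\<sigma> \<in> F" "\<And>\<tau>. \<tau> \<in> F \<Longrightarrow> \<tau> \<noteq> \<sigma> \<Longrightarrow> mincoord \<tau> x = 0" for \<sigma> x v t
  proof -
    have single: "(\<Sum>\<tau>\<in>F. g \<tau>) = g \<sigma>" if "\<And>\<tau>. \<tau> \<in> F \<Longrightarrow> \<tau> \<noteq> \<sigma> \<Longrightarrow> g \<tau> = 0" for g :: "'a set \<Rightarrow> real"
      using sum.remove[OF finF \<open>\<sigma> \<in> F\<close>, of g] sum.neutral[of "F - {\<sigma>}" g] that by simp
    show "cc x = c \<sigma> x" unfolding cc_def using that by (intro single) (simp add: c_def)
    show "z x v = x v - (if v \<in> \<sigma> then mincoord \<sigma> x else 0)"
      unfolding z_def using that
      by (subst single) simp_all
    show "A (t, x) v = 2 / (2 - t) * z x v +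
       (if v \<in> \<sigma> then max 0 (2 * c \<sigma> x - t) / ((2 - t) * real (card \<sigma>)) else 0)" if "t \<ge> 0"
      unfolding A_def case_prod_conv using that \<open>\<And>\<tau>. \<tau> \<in> F \<Longrightarrow> \<tau> \<noteq> \<sigma> \<Longrightarrow> mincoord \<tau> x = 0\<close>
      by (subst single) (simp_all add: c_def)
  qed
  have supp_cases: thesis' if "x \<in> realization X"
      "x \<in> realization K \<Longrightarrow> (\<And>\<tau>. \<tau> \<in> F \<Longrightarrow> mincoord \<tau> x = 0) \<Longrightarrow> thesis'"
      "\<And>\<sigma>. \<sigma> \<in> F \<Longrightarrow> {v. x v \<noteq> 0} = \<sigma> \<Longrightarrow> mincoord \<sigma> x > 0 \<Longrightarrow>
        (\<And>\<tau>. \<tau> \<in> F \<Longrightarrow> \<tau> \<noteq> \<sigma> \<Longrightarrow> mincoord \<tau> x = 0) \<Longrightarrow> thesis'" for x thesis'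
    using facet_support_cases[of X F x thesis', OF X F that(1)] that(2,3) unfolding K_def by blast
  have B_in: "(\<lambda>v. z x v / (1 - cc x)) \<in> realization K" "0 \<le> cc x"
    if x: "x \<in> realization X" and cc: "2 * cc x \<le> 1" for x
  proof -
    have "(\<lambda>v. z x v / (1 - cc x)) \<in> realization K \<and> 0 \<le> cc x"
    proof (cases rule: supp_cases[OF x])
      case hyp: 1
      then show ?thesis using inside[OF hyp(2)] hyp(1) by simp
    next
      case hyp: (2 \<sigma>)
      note eqs = facet[OF hyp(1,4)]
      note f = fin[OF hyp(1)]
      \<comment> \<open>At a vertex \<open>w\<close> of least weight \<open>z x\<close> vanishes.
        The projection is thus supported in \<open>\<sigma> - {w}\<close>, which is a proper face
        and therefore not among the deleted facets.\<close>
      obtain w where w: "w \<in> \<sigma>" "x w = mincoord \<sigma> x" using mincoord_attained[OF f(1,2)] .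
      have "\<sigma> - {w} \<in> X" using finite_complexD(3)[OF X f(4)] by blast
      moreover have "\<sigma> - {w} \<notin> F"
        using fin(3)[of "\<sigma> - {w}"] f(4) w(1) unfolding maximal_simplex_def by blast
      ultimately have mem: "\<sigma> - {w} \<in> K" by (simp add: K_def)
      have "sum (z x) \<sigma> = sum x \<sigma> - c \<sigma> x"
        by (simp add: eqs(2) sum_subtractf c_def)
      also have "sum x \<sigma> = 1" using realization_sum[OF x f(1)] hyp(2) by simp
      finally have "sum (z x) \<sigma> = 1 - cc x" by (simp add: eqs(1))
      moreover have "sum (z x) \<sigma> = sum (z x) (\<sigma> - {w})"
        using sum.remove[OF f(1) w(1), of "z x"] w by (simp add: eqs(2))
      ultimately have sum: "sum (z x) (\<sigma> - {w}) = 1 - cc x" by simp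
      have "(\<lambda>v. z x v / (1 - cc x)) \<in> realization K"
      proof (rule realizationI[OF K mem])
        show "0 \<le> z x v / (1 - cc x)" if "v \<in> \<sigma> - {w}" for v
          using that cc mincoord_le[OF f(1), of v x] by (simp add: eqs(2))
        show "z x v / (1 - cc x) = 0" if "v \<notin> \<sigma> - {w}" for v
          using that w hyp(2) by (auto simp: eqs(2))
        show "(\<Sum>v\<in>\<sigma> - {w}. z x v / (1 - cc x)) = 1"
          using sum cc by (simp add: sum_divide_distrib[symmetric])
      qed
      then show ?thesis using hyp(3) by (simp add: eqs(1) c_def)
    qed
    then show "(\<lambda>v. z x v / (1 - cc x)) \<in> realization K" "0 \<le> cc x" by simp_all
  qed
  have A_in: "A (t, x) \<in> realization X"
    if t: "t \<in> {0..1::real}" and x: "x \<in> realization X" and cc: "t < 2 * cc x" for t x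
  proof (cases rule: supp_cases[OF x])
    case hyp: 1
    then show ?thesis using inside(1)[OF hyp(2)] t cc by simp
  next
    case hyp: (2 \<sigma>)
    note eqs = facet[OF hyp(1,4)]
    note f = fin[OF hyp(1)]
    have t0: "0 \<le> t" "t \<le> 1" using t by auto
    have N: "real (card \<sigma>) > 0" using f(1,2) by (simp add: card_gt_0_iff)
    have zn: "0 \<le> z x v" if "v \<in> \<sigma>" for v
      using that mincoord_le[OF f(1) that, of x] by (simp add: eqs(2))
    have z0: "z x v = 0" if "v \<notin> \<sigma>" for v
      using that hyp(2) by (auto simp: eqs(2))
    have "sum (z x) \<sigma> = sum x \<sigma> - c \<sigma> x"
      by (simp add: eqs(2) sum_subtractf c_def)
    also have "sum x \<sigma> = 1" using realization_sum[OF x f(1)] hyp(2) by simp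
    finally have zs: "sum (z x) \<sigma> = 1 - c \<sigma> x" .
    show ?thesis
    proof (rule realizationI[OF X f(4)])
      show "0 \<le> A (t, x) v" if "v \<in> \<sigma>" for v
        using zn[OF that] t0 N by (simp add: eqs(3))
      show "A (t, x) v = 0" if "v \<notin> \<sigma>" for v
        using that z0[OF that] t0 by (simp add: eqs(3))
      have "sum (A (t, x)) \<sigma> = (\<Sum>v\<in>\<sigma>. 2 / (2 - t) * z x v +
          (2 * c \<sigma> x - t) / ((2 - t) * real (card \<sigma>)))"
        using t0 cc by (intro sum.cong) (simp_all add: eqs(1,3))
      also have "\<dots> = 2 / (2 - t) * (1 - c \<sigma> x) + real (card \<sigma>) * ((2 * c \<sigma> x - t) / ((2 - t) * real (card \<sigma>)))"
        by (simp only: sum.distrib sum_distrib_left[symmetric] zs sum_constant)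
      also have "\<dots> = 2 / (2 - t) * (1 - c \<sigma> x) + (2 * c \<sigma> x - t) / (2 - t)"
        using N by simp
      also have "\<dots> = (2 * (1 - c \<sigma> x) + (2 * c \<sigma> x - t)) / (2 - t)"
        by (simp only: add_divide_distrib times_divide_eq_left)
      also have "2 * (1 - c \<sigma> x) + (2 * c \<sigma> x - t) = 2 - t" by simp
      also have "(2 - t) / (2 - t) = 1" using t0 by simp
      finally show "sum (A (t, x)) \<sigma> = 1" .
    qed
  qed
  have AB: "A (t, x) = B (t, x)"
    if t: "t \<in> {0..1::real}" and x: "x \<in> realization X" and cc: "2 * cc x = t" for t x
  proof
    fix v
    have B: "B (t, x) v = z x v / (1 - cc x)" using cc by (simp add: B_def G0)
    have "c \<sigma> x \<le> cc x" if "\<sigma> \<in> F" for \<sigma>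
      unfolding cc_def using that finF mincoord_pos_iff(1)[OF x fin(1,2)]
      by (intro member_le_sum) (auto simp: c_def)
    \<comment> \<open>On the edge of the collar every \<open>c \<sigma> x\<close> is at most
      \<open>cc x = t / 2\<close>, so the barycenter terms of \<open>A\<close> disappear.\<close>
    then have "max 0 (2 * c \<sigma> x - t) = 0" if "\<sigma> \<in> F" for \<sigma>
      using that cc by fastforce
    then have "(\<Sum>\<sigma>\<in>F. if v \<in> \<sigma> then max 0 (2 * c \<sigma> x - t) / ((2 - t) * real (card \<sigma>)) else 0) = 0"
      by (intro sum.neutral) auto
    then have "A (t, x) v = 2 / (2 - t) * z x v" by (simp add: A_def)
    also have "2 / (2 - t) = 1 / (1 - cc x)" using cc t by (auto simp: field_simps)
    finally show "A (t, x) v = B (t, x) v" using B by simp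
  qed
  have cont_x: "continuous_on S (\<lambda>q. snd q v)" for S :: "(real \<times> ('a \<Rightarrow> real)) set" and v
    by (rule continuous_on_product_then_coordinatewise[OF continuous_on_snd[OF continuous_on_id]])
  have cont_min: "continuous_on S (\<lambda>q. mincoord \<sigma> (snd q))" if "\<sigma> \<in> F"
    for S :: "(real \<times> ('a \<Rightarrow> real)) set" and \<sigma>
    using fin(1,2)[OF that] by (intro continuous_on_mincoord continuous_intros)
  have cont_c: "continuous_on S (\<lambda>q. c \<sigma> (snd q))" if "\<sigma> \<in> F"
    for S :: "(real \<times> ('a \<Rightarrow> real)) set" and \<sigma>
    unfolding c_def by (intro continuous_intros cont_min that)
  have cont_cc: "continuous_on S (\<lambda>q. cc (snd q))" for S :: "(real \<times> ('a \<Rightarrow> real)) set"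
    unfolding cc_def by (intro continuous_intros cont_c)
  have cont_if: "continuous_on S (\<lambda>q. if b then g q else 0)" if "continuous_on S g"
    for S :: "(real \<times> ('a \<Rightarrow> real)) set" and b and g :: "_ \<Rightarrow> real"
    using that by (cases b) simp_all
  have cont_z: "continuous_on S (\<lambda>q. z (snd q) v)" for S :: "(real \<times> ('a \<Rightarrow> real)) set" and v
    unfolding z_def by (intro continuous_intros cont_if cont_min cont_x)
  have contA: "continuous_on {q \<in> {0..1::real} \<times> realization X. 0 \<le> 2 * cc (snd q) - fst q} A"
    unfolding A_def case_prod_unfold
    using fin(1,2)
    by (intro continuous_on_coordinatewise_then_product continuous_intros cont_if cont_c cont_z) auto
  have contB: "continuous_on {q \<in> {0..1::real} \<times> realization X. 2 * cc (snd q) - fst q \<le> 0} B"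
    unfolding B_def case_prod_unfold
  proof (rule continuous_on_compose2[OF contG])
    show "continuous_on {q \<in> {0..1::real} \<times> realization X. 2 * cc (snd q) - fst q \<le> 0}
        (\<lambda>q. (fst q - 2 * cc (snd q), \<lambda>v. z (snd q) v / (1 - cc (snd q))))"
      by (intro continuous_on_Pair continuous_on_coordinatewise_then_product continuous_intros
          cont_cc cont_z) auto
    have "(t - 2 * cc x, \<lambda>v. z x v / (1 - cc x)) \<in> {0..1::real} \<times> realization K"
      if "t \<in> {0..1::real}" "x \<in> realization X" "2 * cc x - t \<le> 0" for t x
      using B_in[OF that(2)] that by auto
    then show "(\<lambda>q. (fst q - 2 * cc (snd q), \<lambda>v. z (snd q) v / (1 - cc (snd q)))) `
        {q \<in> {0..1::real} \<times> realization X. 2 * cc (snd q) - fst q \<le> 0} \<subseteq> {0..1::real} \<times> realization K"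
      by auto
  qed
  have contH: "continuous_on ({0..1::real} \<times> realization X) H"
    unfolding H_def
  proof (rule continuous_on_cases_le[OF contB contA])
    show "continuous_on ({0..1::real} \<times> realization X) (\<lambda>q. 2 * cc (snd q) - fst q)"
      by (intro continuous_intros cont_cc)
    show "B q = A q" if "q \<in> {0..1::real} \<times> realization X" "2 * cc (snd q) - fst q = 0" for q
      using AB[of "fst q" "snd q"] that by auto
  qed
  have KX: "realization K \<subseteq> realization X" by (auto simp: realization_def K_def)
  have HB: "H (t, x) \<in> realization K" if "t \<in> {0..1::real}" "x \<in> realization X" "2 * cc x \<le> t" for t x
    using B_in[OF that(2)] that GK by (simp add: H_def B_def)
  have HX: "H (t, x) \<in> realization X" if t: "t \<in> {0..1::real}" and x: "x \<in> realization X" for t x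
  proof (cases "2 * cc x \<le> t")
    case True
    then show ?thesis using HB[OF t x] KX by blast
  next
    case False
    then show ?thesis using A_in[OF t x] by (simp add: H_def)
  qed
  have H0: "H (0, x) = x" if x: "x \<in> realization X" for x
  proof (cases rule: supp_cases[OF x])
    case hyp: 1
    then show ?thesis using inside[OF hyp(2)]
      by (simp add: H_def B_def G0)
  next
    case hyp: (2 \<sigma>)
    note eqs = facet[OF hyp(1,4)]
    have N: "real (card \<sigma>) > 0" using fin(1,2)[OF hyp(1)] by (simp add: card_gt_0_iff)
    have "0 < c \<sigma> x" using N hyp(3) by (simp add: c_def)
    then have "H (0, x) = A (0, x)" by (simp add: H_def eqs(1))
    moreover have "A (0, x) v = x v" for v
      using N hyp(3) by (simp add: eqs(2,3) c_def)
    ultimately show ?thesis by auto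
  qed
  have HK: "H (t, x) = G (t, x)" if t: "t \<in> {0..1::real}" and x: "x \<in> realization K" for t x
  proof -
    have "mincoord \<tau> x = 0" if "\<tau> \<in> F" for \<tau>
    proof -
      have "\<not> \<tau> \<subseteq> {v. x v \<noteq> 0}"
        using fin(3)[OF that] realizationD(2)[OF x] that unfolding maximal_simplex_def K_def by blast
      then show ?thesis using mincoord_pos_iff[OF x fin(1,2)[OF that]] by linarith
    qed
    then show ?thesis using inside[of x] t by (simp add: H_def B_def)
  qed
  obtain x0 where x0: "x0 \<in> realization K" using ne K_def by blast
  show thesis
  proof (rule that[OF contH HX H0])
    show "H (t, x) \<in> realization (X - F)" if "t \<in> {0..1::real}" "x \<in> realization (X - F)" for t x
      using HK GK that by (simp add: K_def)
    show "H (1, x) = p" if "x \<in> realization (X - F)" for x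
      using HK[of 1 x] G1 that by (simp add: K_def)
    show "p \<in> realization (X - F)" using GK[of 1 x0] x0 G1 by (simp add: K_def)
  qed
qed

section \<open>Collapsing a contractible subspace\<close>

text \<open>The end of \<open>H\<close> is constant on \<open>A\<close> and so descends to a map
  \<open>g\<close> from \<open>W\<close> back to \<open>X\<close>, and \<open>H\<close> itself
  connects the identity with \<open>g \<circ> q\<close>. As \<open>H\<close> preserves
  \<open>A\<close>, the map \<open>q \<circ> H\<close> also descends and connects the identity of
  \<open>W\<close> with \<open>q \<circ> g\<close>.\<close>

lemma quotient_homotopy_equivalent:
  assumes X: "compact_space X" and W: "Hausdorff_space W"
    and q: "continuous_map X W q" "q ` topspace X = topspace W"
    and inj: "\<And>x y. x \<in> topspace X \<Longrightarrow> y \<in> topspace X \<Longrightarrow> q x = q y \<Longrightarrow> x = y \<or> x \<in> A \<and> y \<in> A"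
    and const: "\<And>x y. x \<in> A \<Longrightarrow> y \<in> A \<Longrightarrow> q x = q y"
    and H: "continuous_map (prod_topology (top_of_set {0..1::real}) X) X H"
    and H0: "\<And>x. x \<in> topspace X \<Longrightarrow> H (0, x) = x"
    and HA: "\<And>t x. t \<in> {0..1} \<Longrightarrow> x \<in> A \<Longrightarrow> H (t, x) \<in> A"
    and H1: "\<And>x. x \<in> A \<Longrightarrow> H (1, x) = p"
  shows "X homotopy_equivalent_space W"
proof -
  let ?I = "top_of_set {0..1::real}"
  have qm: "quotient_map X W q"
    using continuous_imp_quotient_map q X W by blast
  have contH1: "continuous_map X X (\<lambda>x. H (1, x))"
    using continuous_map_compose[OF _ H, of X "\<lambda>x. (1, x)"] by (simp add: continuous_map_pairwise o_def)
  have fib: "H (1, x) = H (1, y)" if "x \<in> topspace X" "y \<in> topspace X" "q x = q y" for x y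
    using inj[OF that] H1 by auto
  obtain g where g: "continuous_map W X g" "g ` topspace W = (\<lambda>x. H (1, x)) ` topspace X"
      "\<And>x. x \<in> topspace X \<Longrightarrow> g (q x) = H (1, x)"
    by (rule quotient_map_lift_exists[OF qm contH1], rule fib, assumption+, rule that)
  \<comment> \<open>Descent of the homotopy needs the product of the identity with \<open>q\<close>
    to be a quotient map; this follows from a compact source and a Hausdorff target, as for
    \<open>q\<close>.\<close>
  define Q where "Q = (\<lambda>(t::real, x). (t, q x))"
  have "compact_space (prod_topology ?I X)"
    using X by (simp add: compact_space_prod_topology compact_space_subtopology)
  moreover have "Hausdorff_space (prod_topology ?I W)"
    using W by (simp add: Hausdorff_space_prod_topology Hausdorff_space_subtopology)
  moreover have "continuous_map (prod_topology ?I X) (prod_topology ?I W) Q"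
    unfolding Q_def case_prod_unfold
    using continuous_map_compose[OF continuous_map_snd q(1), of ?I]
    by (intro continuous_map_pairedI continuous_map_fst) (simp add: o_def)
  moreover have "Q ` topspace (prod_topology ?I X) = topspace (prod_topology ?I W)"
    unfolding q(2)[symmetric] topspace_prod_topology Q_def by force
  ultimately have qm': "quotient_map (prod_topology ?I X) (prod_topology ?I W) Q"
    by (intro continuous_imp_quotient_map)
  have cont: "continuous_map (prod_topology ?I X) W (q \<circ> H)"
    using continuous_map_compose[OF H q(1)] .
  have fib': "(q \<circ> H) x = (q \<circ> H) y"
    if "x \<in> topspace (prod_topology ?I X)" "y \<in> topspace (prod_topology ?I X)" "Q x = Q y" for x y
  proof -
    obtain t x' y' where xy: "x = (t, x')" "y = (t, y')" "q x' = q y'"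
      using \<open>Q x = Q y\<close> by (cases x, cases y) (auto simp: Q_def)
    then have mem: "t \<in> {0..1}" "x' \<in> topspace X" "y' \<in> topspace X" using that by simp_all
    from inj[OF mem(2,3) xy(3)] have "q (H (t, x')) = q (H (t, y'))"
      using const[OF HA HA] mem(1) by blast
    then show ?thesis by (simp add: xy)
  qed
  obtain K where K: "continuous_map (prod_topology ?I W) W K"
    "K ` topspace (prod_topology ?I W) = (q \<circ> H) ` topspace (prod_topology ?I X)"
    "\<And>z. z \<in> topspace (prod_topology ?I X) \<Longrightarrow> K (Q z) = (q \<circ> H) z"
    by (rule quotient_map_lift_exists[OF qm' cont], rule fib', assumption+, rule that)
  have KQ: "K (t, q x) = q (H (t, x))" if "t \<in> {0..1}" "x \<in> topspace X" for t x
    using K(3)[of "(t, x)"] that by (simp add: Q_def)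
  have "homotopic_with (\<lambda>_. True) X X id (g \<circ> q)"
    using H H0 g(3) by (subst homotopic_with) (auto intro!: exI[of _ H])
  then have 1: "homotopic_with (\<lambda>_. True) X X (g \<circ> q) id" by (rule homotopic_with_symD)
  have "K (0, w) = w \<and> K (1, w) = q (g w)" if w: "w \<in> topspace W" for w
  proof -
    obtain x where x: "x \<in> topspace X" "w = q x" using w unfolding q(2)[symmetric] by (rule imageE)
    then show ?thesis using KQ[OF _ x(1), of 0] KQ[OF _ x(1), of 1] H0[OF x(1)] g(3)[OF x(1)] by simp
  qed
  then have "homotopic_with (\<lambda>_. True) W W id (q \<circ> g)"
    using K(1) by (subst homotopic_with) (auto intro!: exI[of _ K])
  then have 2: "homotopic_with (\<lambda>_. True) W W (q \<circ> g) id" by (rule homotopic_with_symD)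
  show ?thesis
    unfolding homotopy_equivalent_space_def using q(1) g(1) 1 2 by blast
qed

section \<open>Simplices modulo their boundary\<close>

text \<open>A set of vertices is a simplex iff it contains no nonface, and a support contains no
  nonface iff the coordinate product over each nonface is 0. Membership thus becomes a family of
  weak inequalities and equations between continuous functions, which makes closedness
  immediate.\<close>

lemma realization_subset_support:
  assumes "finite_complex X"
  shows "realization X = {x. (\<forall>v. 0 \<le> x v) \<and> (\<forall>v. v \<notin> \<Union>X \<longrightarrow> x v = 0) \<and> sum x (\<Union>X) = 1 \<and>
    (\<forall>S. S \<in> Pow (\<Union>X) - X \<longrightarrow> (\<Prod>v\<in>S. x v) = 0)}" (is "_ = ?R")
proof (intro set_eqI iffI)
  have fin: "finite (\<Union>X)" using finite_complexD(1,2)[OF assms] by blast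
  fix x
  {
    assume x: "x \<in> realization X"
    have sub: "{v. x v \<noteq> 0} \<subseteq> \<Union>X" using realizationD(2)[OF x] by blast
    have "(\<Prod>v\<in>S. x v) = 0" if S: "S \<in> Pow (\<Union>X) - X" for S
    proof -
      have "\<not> S \<subseteq> {v. x v \<noteq> 0}"
        using finite_complexD(3)[OF assms realizationD(2)[OF x], of S] S by blast
      moreover have "finite S" using S fin finite_subset by blast
      ultimately show ?thesis by (subst prod_zero_iff) blast+
    qed
    moreover have "sum x (\<Union>X) = 1" using realization_sum[OF x fin sub] .
    moreover have "x v = 0" if "v \<notin> \<Union>X" for v using sub that by blast
    ultimately show "x \<in> ?R" using realizationD(1)[OF x] by blast
  next
    assume x: "x \<in> ?R"
    have sub: "{v. x v \<noteq> 0} \<subseteq> \<Union>X" using x by blast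
    then have "finite {v. x v \<noteq> 0}" using fin finite_subset by blast
    then have "(\<Prod>v | x v \<noteq> 0. x v) \<noteq> 0" by simp
    then have "{v. x v \<noteq> 0} \<in> X" using x sub by blast
    moreover have "(\<Sum>v | x v \<noteq> 0. x v) = sum x (\<Union>X)"
      using sub fin by (intro sum.mono_neutral_left) auto
    ultimately show "x \<in> realization X" using x by (simp add: realization_def)
  }
qed

lemma closed_realization:
  assumes "finite_complex X"
  shows "closed (realization X)"
proof -
  have c: "continuous_on UNIV (\<lambda>x::'a \<Rightarrow> real. x v)" for v by simp
  have imp: "closed {x::'a \<Rightarrow> real. b \<longrightarrow> P x}" if "closed {x. P x}" for b P
    using that by (cases b) simp_all
  show ?thesis
    unfolding realization_subset_support[OF assms]
    by (intro closed_Collect_conj closed_Collect_all imp closed_Collect_le closed_Collect_eq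
        continuous_intros c)
qed

lemma compact_space_realization:
  assumes "finite_complex X"
  shows "compact_space (top_of_set (realization X))"
proof -
  \<comment> \<open>The factors outside the vertex set are the single point 0, so every factor is
    compact and so is the product, even over an infinite type of vertices.\<close>
  let ?B = "\<lambda>v. if v \<in> \<Union>X then {0..1::real} else {0}"
  have "compactin (powertop_real UNIV) (\<Pi>\<^sub>E v\<in>UNIV. ?B v)"
    by (simp add: compactin_PiE)
  then have B: "compactin euclidean (\<Pi>\<^sub>E v\<in>UNIV. ?B v)"
    by (simp add: euclidean_product_topology)
  have "realization X \<subseteq> (\<Pi>\<^sub>E v\<in>UNIV. ?B v)"
  proof
    fix x assume x: "x \<in> realization X"
    have fin: "finite (\<Union>X)" using finite_complexD(1,2)[OF assms] by blast
    have "x v \<in> ?B v" for v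
    proof (cases "v \<in> \<Union>X")
      case True
      have "x v \<le> sum x (\<Union>X)"
        using True fin realizationD(1)[OF x] by (intro member_le_sum) auto
      also have "\<dots> = 1"
        using realizationD(2)[OF x] by (intro realization_sum[OF x fin]) blast
      finally show ?thesis using True realizationD(1)[OF x] by simp
    next
      case False
      then show ?thesis using realizationD(2)[OF x] by auto
    qed
    then show "x \<in> (\<Pi>\<^sub>E v\<in>UNIV. ?B v)" by (intro PiE_I) simp_all
  qed
  then have "compactin euclidean (realization X)"
    using closed_compactin[OF B] closed_realization[OF assms] by simp
  then show ?thesis by (rule compact_space_subtopology)
qed

section \<open>An open simplex as a punctured sphere\<close>

lemma finite_complex_Pow: "finite \<sigma> \<Longrightarrow> finite_complex (Pow \<sigma>)"
  by (rule finite_complexI) (auto intro: finite_subset)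

text \<open>Inverse stereographic projection applied to \<open>(x (e i) - x (e 0)) / \<mu>\<close> for
  \<open>1 \<le> i \<le> d\<close>, where \<open>\<mu>\<close> is the least barycentric coordinate, with denominators cleared.\<close>

definition simplex_to_sphere :: "nat \<Rightarrow> (nat \<Rightarrow> 'a) \<Rightarrow> ('a \<Rightarrow> real) \<Rightarrow> nat \<Rightarrow> real" where
  "simplex_to_sphere d e x =
    (let \<mu> = mincoord (e ` {..d}) x;
         s = (\<Sum>i\<le>d. (x (e i) - x (e 0))\<^sup>2)
     in (\<lambda>i. if i = 0 then (s - \<mu>\<^sup>2) / (s + \<mu>\<^sup>2)
            else if i \<le> d then 2 * \<mu> * (x (e i) - x (e 0)) / (s + \<mu>\<^sup>2) else 0))"

abbreviation (input) edge_sum :: "nat \<Rightarrow> (nat \<Rightarrow> 'a) \<Rightarrow> ('a \<Rightarrow> real) \<Rightarrow> real" where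
  "edge_sum d e x \<equiv> \<Sum>i\<le>d. (x (e i) - x (e 0))\<^sup>2"

context
  fixes \<sigma> :: "'a set" and d :: nat and e :: "nat \<Rightarrow> 'a"
  assumes e: "bij_betw e {..d} \<sigma>"
begin

lemma enum_image: "e ` {..d} = \<sigma>"
  using e by (simp add: bij_betw_def)

lemma finite_simplex: "finite \<sigma>" "\<sigma> \<noteq> {}" "\<And>i. i \<le> d \<Longrightarrow> e i \<in> \<sigma>"
  using enum_image by auto

lemma sum_simplex: "sum f \<sigma> = (\<Sum>i\<le>d. f (e i))"
  using sum.reindex_bij_betw[OF e, of f] by simp

lemma simplex_to_sphere_simps:
  "simplex_to_sphere d e x 0 = (edge_sum d e x - (mincoord \<sigma> x)\<^sup>2) / (edge_sum d e x + (mincoord \<sigma> x)\<^sup>2)"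
  "0 < i \<Longrightarrow> i \<le> d \<Longrightarrow> simplex_to_sphere d e x i = 2 * mincoord \<sigma> x * (x (e i) - x (e 0)) / (edge_sum d e x + (mincoord \<sigma> x)\<^sup>2)"
  "d < i \<Longrightarrow> simplex_to_sphere d e x i = 0"
  by (simp_all add: simplex_to_sphere_def Let_def enum_image)

text \<open>If both terms vanish, all coordinates agree and the least one is 0, contradicting total
  weight 1. Hence the formulas remain continuous up to the boundary.\<close>

lemma denominator_pos:
  assumes x: "x \<in> realization (Pow \<sigma>)"
  shows "0 < edge_sum d e x + (mincoord \<sigma> x)\<^sup>2"
proof (rule ccontr)
  assume "\<not> 0 < edge_sum d e x + (mincoord \<sigma> x)\<^sup>2"
  moreover have "0 \<le> edge_sum d e x" by (intro sum_nonneg) simp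
  moreover have "0 \<le> (mincoord \<sigma> x)\<^sup>2" by simp
  ultimately have "edge_sum d e x = 0" "(mincoord \<sigma> x)\<^sup>2 = 0" by linarith+
  then have "mincoord \<sigma> x = 0" by simp
  have "\<forall>i\<in>{..d}. (x (e i) - x (e 0))\<^sup>2 = 0"
    by (rule iffD1[OF sum_nonneg_eq_0_iff \<open>edge_sum d e x = 0\<close>]) simp_all
  then have const: "x (e i) = x (e 0)" if "i \<le> d" for i
    using that by (metis atMost_iff eq_iff_diff_eq_0 power_eq_0_iff)
  obtain w where w: "w \<in> \<sigma>" "x w = mincoord \<sigma> x" using mincoord_attained[OF finite_simplex(1,2)] .
  then obtain j where j: "j \<le> d" "w = e j" using enum_image by auto
  have "x (e i) = 0" if "i \<le> d" for i
    using const[OF that] const[OF j(1)] w(2) j(2) \<open>mincoord \<sigma> x = 0\<close> by simp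
  then have "sum x \<sigma> = 0" by (simp add: sum_simplex)
  moreover have "sum x \<sigma> = 1"
    using realizationD(2)[OF x] by (intro realization_sum[OF x finite_simplex(1)]) simp
  ultimately show False by simp
qed

lemma simplex_to_sphere_in:
  assumes x: "x \<in> realization (Pow \<sigma>)"
  shows "simplex_to_sphere d e x \<in> topspace (nsphere d)"
proof -
  define D where "D = edge_sum d e x + (mincoord \<sigma> x)\<^sup>2"
  have D: "D > 0" using denominator_pos[OF x] by (simp add: D_def)
  have "(\<Sum>i\<le>d. (simplex_to_sphere d e x i)\<^sup>2) = (simplex_to_sphere d e x 0)\<^sup>2 + (\<Sum>i\<in>{..d} - {0}. (simplex_to_sphere d e x i)\<^sup>2)"
    by (intro sum.remove) auto
  also have "(\<Sum>i\<in>{..d} - {0}. (simplex_to_sphere d e x i)\<^sup>2) =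
      (\<Sum>i\<in>{..d} - {0}. 4 * (mincoord \<sigma> x)\<^sup>2 / D\<^sup>2 * (x (e i) - x (e 0))\<^sup>2)"
    by (intro sum.cong) (auto simp: simplex_to_sphere_simps D_def power_divide power_mult_distrib)
  also have "\<dots> = 4 * (mincoord \<sigma> x)\<^sup>2 / D\<^sup>2 * (\<Sum>i\<in>{..d} - {0}. (x (e i) - x (e 0))\<^sup>2)"
    by (rule sum_distrib_left[symmetric])
  also have "(\<Sum>i\<in>{..d} - {0}. (x (e i) - x (e 0))\<^sup>2) = edge_sum d e x"
    by (intro sum.mono_neutral_left) auto
  also have "(simplex_to_sphere d e x 0)\<^sup>2 + 4 * (mincoord \<sigma> x)\<^sup>2 / D\<^sup>2 * edge_sum d e x = ((edge_sum d e x - (mincoord \<sigma> x)\<^sup>2)\<^sup>2 + 4 * (mincoord \<sigma> x)\<^sup>2 * edge_sum d e x) / D\<^sup>2"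
    by (simp add: simplex_to_sphere_simps D_def power_divide add_divide_distrib)
  also have "(edge_sum d e x - (mincoord \<sigma> x)\<^sup>2)\<^sup>2 + 4 * (mincoord \<sigma> x)\<^sup>2 * edge_sum d e x = D\<^sup>2"
    unfolding D_def by algebra
  finally have "(\<Sum>i\<le>d. (simplex_to_sphere d e x i)\<^sup>2) = 1" using D by simp
  then show ?thesis by (simp add: nsphere simplex_to_sphere_simps(3))
qed

lemma continuous_on_simplex_to_sphere: "continuous_on (realization (Pow \<sigma>)) (simplex_to_sphere d e)"
proof (rule continuous_on_coordinatewise_then_product)
  fix i
  have x: "continuous_on (realization (Pow \<sigma>)) (\<lambda>x. x v)" for v
    by (rule continuous_on_subset[OF continuous_on_product_coordinates]) simp
  have m: "continuous_on (realization (Pow \<sigma>)) (mincoord \<sigma>)"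
    by (intro continuous_on_mincoord finite_simplex continuous_on_id)
  have D: "edge_sum d e x + (mincoord \<sigma> x)\<^sup>2 \<noteq> 0" if "x \<in> realization (Pow \<sigma>)" for x
    using denominator_pos[OF that] by simp
  consider "i = 0" | "0 < i" "i \<le> d" | "d < i" by linarith
  then show "continuous_on (realization (Pow \<sigma>)) (\<lambda>x. simplex_to_sphere d e x i)"
  proof cases
    case 1
    show ?thesis unfolding 1 simplex_to_sphere_simps(1) using D by (intro continuous_intros x m) auto
  next
    case 2
    show ?thesis unfolding simplex_to_sphere_simps(2)[OF 2] using D by (intro continuous_intros x m) auto
  next
    case 3
    show ?thesis unfolding simplex_to_sphere_simps(3)[OF 3] by (rule continuous_on_const)
  qed
qed

text \<open>The pole of the stereographic projection is the base point used in
  \<open>sphere_wedge\<close>. Its preimage is exactly the boundary, the part of a facet that the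
  quotient map identifies to a point.\<close>

lemma simplex_to_sphere_base_iff:
  assumes x: "x \<in> realization (Pow \<sigma>)"
  shows "simplex_to_sphere d e x = (\<lambda>j. if j = 0 then 1 else 0) \<longleftrightarrow> mincoord \<sigma> x = 0"
proof
  assume "simplex_to_sphere d e x = (\<lambda>j. if j = 0 then 1 else 0)"
  then have "simplex_to_sphere d e x 0 = 1" by simp
  then show "mincoord \<sigma> x = 0" using denominator_pos[OF x] by (simp add: simplex_to_sphere_simps(1) divide_simps)
next
  assume 0: "mincoord \<sigma> x = 0"
  have "simplex_to_sphere d e x j = (if j = 0 then 1 else 0)" for j
    using 0 denominator_pos[OF x] simplex_to_sphere_simps(2)[of j x] simplex_to_sphere_simps(3)[of j x]
    by (cases "j = 0"; cases "j \<le> d") (simp_all add: simplex_to_sphere_simps(1))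
  then show "simplex_to_sphere d e x = (\<lambda>j. if j = 0 then 1 else 0)" by blast
qed

text \<open>Stereographic projection from the pole undoes the construction; the computation rests on
  1 minus the zeroth coordinate being \<open>2 * (mincoord \<sigma> x)\<^sup>2 / D\<close>.\<close>

lemma simplex_to_sphere_ratio:
  assumes x: "x \<in> realization (Pow \<sigma>)" and pos: "mincoord \<sigma> x > 0" and i: "i \<le> d"
  shows "x (e i) - x (e 0) = mincoord \<sigma> x * (if i = 0 then 0 else simplex_to_sphere d e x i / (1 - simplex_to_sphere d e x 0))"
proof (cases "i = 0")
  case False
  define D where "D = edge_sum d e x + (mincoord \<sigma> x)\<^sup>2"
  have D: "D > 0" using denominator_pos[OF x] by (simp add: D_def)
  have 1: "1 - simplex_to_sphere d e x 0 = 2 * (mincoord \<sigma> x)\<^sup>2 / D"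
    using D by (simp add: simplex_to_sphere_simps(1) D_def field_simps)
  have 2: "simplex_to_sphere d e x i = 2 * mincoord \<sigma> x * (x (e i) - x (e 0)) / D"
    using False i by (simp add: simplex_to_sphere_simps(2) D_def)
  show ?thesis
    unfolding 1 2 using pos D False by (simp add: power2_eq_square)
qed simp

text \<open>Equal images make the coordinate differences of \<open>y\<close> a multiple
  \<open>r\<close> of those of \<open>x\<close>, so \<open>y = r * x + k\<close> on
  \<open>\<sigma>\<close>. Evaluating at a minimizer of \<open>x\<close> and at one of
  \<open>y\<close> forces \<open>k = 0\<close>, and total weight 1 forces
  \<open>r = 1\<close>.\<close>

lemma simplex_to_sphere_inj:
  assumes x: "x \<in> realization (Pow \<sigma>)" "mincoord \<sigma> x > 0" and y: "y \<in> realization (Pow \<sigma>)" "mincoord \<sigma> y > 0"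
    and eq: "simplex_to_sphere d e x = simplex_to_sphere d e y"
  shows "x = y"
proof -
  define r where "r = mincoord \<sigma> y / mincoord \<sigma> x"
  define k where "k = y (e 0) - r * x (e 0)"
  have k: "y v = r * x v + k" if v: "v \<in> \<sigma>" for v
  proof -
    obtain i where i: "i \<le> d" "v = e i" using v enum_image by auto
    define p where "p = (if i = 0 then 0 else simplex_to_sphere d e x i / (1 - simplex_to_sphere d e x 0))"
    have "x v - x (e 0) = mincoord \<sigma> x * p" "y v - y (e 0) = mincoord \<sigma> y * p"
      using simplex_to_sphere_ratio[OF x i(1)] simplex_to_sphere_ratio[OF y i(1)] eq i(2)
      by (simp_all add: p_def)
    then have "y v - y (e 0) = r * (x v - x (e 0))" using x(2) by (simp add: r_def)
    then show ?thesis by (simp add: k_def algebra_simps)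
  qed
  have r: "r > 0" "r * mincoord \<sigma> x = mincoord \<sigma> y" using x(2) y(2) by (simp_all add: r_def)
  obtain a where a: "a \<in> \<sigma>" "x a = mincoord \<sigma> x" using mincoord_attained[OF finite_simplex(1,2)] .
  obtain b where b: "b \<in> \<sigma>" "y b = mincoord \<sigma> y" using mincoord_attained[OF finite_simplex(1,2)] .
  have "k \<ge> 0" using k[OF a(1)] a(2) r mincoord_le[OF finite_simplex(1) a(1), of y] by simp
  moreover have "k \<le> 0"
    using k[OF b(1)] b(2) r mult_left_mono[OF mincoord_le[OF finite_simplex(1) b(1), of x], of r] by simp
  ultimately have k0: "y v = r * x v" if "v \<in> \<sigma>" for v using k[OF that] by simp
  have sums: "sum x \<sigma> = 1" "sum y \<sigma> = 1"
    using realizationD(2)[OF x(1)] realizationD(2)[OF y(1)]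
    by (auto intro!: realization_sum[OF x(1) finite_simplex(1)] realization_sum[OF y(1) finite_simplex(1)])
  have "sum y \<sigma> = r * sum x \<sigma>" unfolding sum_distrib_left using k0 by (intro sum.cong) auto
  then have "r = 1" using sums by simp
  show ?thesis
  proof
    fix v
    show "x v = y v"
    proof (cases "v \<in> \<sigma>")
      case True
      then show ?thesis using k0 \<open>r = 1\<close> by simp
    next
      case False
      then have "x v = 0" "y v = 0"
        using realizationD(2)[OF x(1)] realizationD(2)[OF y(1)] by blast+
      then show ?thesis by simp
    qed
  qed
qed

lemma simplex_to_sphere_surj:
  assumes y: "y \<in> topspace (nsphere d)" "y \<noteq> (\<lambda>j. if j = 0 then 1 else 0)"
  obtains x where "x \<in> realization (Pow \<sigma>)" "mincoord \<sigma> x > 0" "simplex_to_sphere d e x = y"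
proof -
  have y0: "y i = 0" if "i > d" for i
    using y(1) that by (simp_all add: nsphere)
  have ysum: "(\<Sum>i\<le>d. (y i)\<^sup>2) = 1" using y(1) by (simp add: nsphere)
  define Y where "Y = (\<Sum>i\<in>{..d} - {0}. (y i)\<^sup>2)"
  have Y: "(y 0)\<^sup>2 + Y = 1"
    using ysum sum.remove[of "{..d}" 0 "\<lambda>i. (y i)\<^sup>2"] by (simp add: Y_def)
  have Y_nn: "Y \<ge> 0" unfolding Y_def by (intro sum_nonneg) simp
  have lt: "y 0 < 1"
  proof (rule ccontr)
    assume "\<not> y 0 < 1"
    then have "1 \<le> (y 0)\<^sup>2" by (simp add: one_le_power)
    then have "(y 0)\<^sup>2 = 1" "Y = 0" using Y Y_nn by linarith+
    then have "y 0 = 1" using \<open>\<not> y 0 < 1\<close> by (simp add: power2_eq_1_iff)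
    moreover have "y i = 0" if "i \<noteq> 0" for i
      using \<open>Y = 0\<close> that y0[of i] unfolding Y_def by (cases "i \<le> d") (auto simp: sum_nonneg_eq_0_iff)
    ultimately have "y = (\<lambda>j. if j = 0 then 1 else 0)" by auto
    then show False using y(2) by simp
  qed
  \<comment> \<open>The stereographic coordinates of \<open>y\<close>, with entry 0 for the vertex
    \<open>e 0\<close>. The weights \<open>1 + p i - m\<close> have least value 1 and differ from
    the weight of \<open>e 0\<close> by \<open>p i\<close>, so their differences divided by the
    least weight are again \<open>p\<close>; division by \<open>T\<close> normalizes the
    total.\<close>
  define p where "p i = (if i = 0 then 0 else y i / (1 - y 0))" for i :: nat
  define m where "m = Min (p ` {..d})"
  define T where "T = (\<Sum>i\<le>d. 1 + p i - m)"
  have m_le: "m \<le> p i" if "i \<le> d" for i using that by (simp add: m_def)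
  have "m \<in> p ` {..d}" unfolding m_def by (intro Min_in) auto
  then obtain j where j: "j \<le> d" "p j = m" by auto
  have "0 < 1 + p 0 - m" using m_le[of 0] by simp
  also have "\<dots> \<le> T" unfolding T_def
  proof (rule member_le_sum)
    show "0 \<le> 1 + p i - m" if "i \<in> {..d} - {0}" for i using m_le[of i] that by simp
  qed simp_all
  finally have T: "T > 0" .
  define x where "x v = (if v \<in> \<sigma> then (1 + p (inv_into {..d} e v) - m) / T else 0)" for v
  have xe: "x (e i) = (1 + p i - m) / T" if "i \<le> d" for i
    using that e finite_simplex(3)[OF that] by (simp add: x_def bij_betw_inv_into_left)
  have x: "x \<in> realization (Pow \<sigma>)"
  proof (rule realizationI[OF finite_complex_Pow[OF finite_simplex(1)], of \<sigma>])
    show "0 \<le> x v" if v: "v \<in> \<sigma>" for v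
    proof -
      obtain i where "i \<le> d" "v = e i" using v enum_image by auto
      then show ?thesis using xe m_le[of i] T by simp
    qed
    show "x v = 0" if "v \<notin> \<sigma>" for v using that by (simp add: x_def)
    have "sum x \<sigma> = (\<Sum>i\<le>d. (1 + p i - m) / T)" unfolding sum_simplex by (intro sum.cong) (simp_all add: xe)
    also have "\<dots> = 1" using T by (simp add: sum_divide_distrib[symmetric] T_def[symmetric])
    finally show "sum x \<sigma> = 1" .
  qed simp
  have mincoord_eq: "mincoord \<sigma> x = 1 / T"
  proof (rule antisym)
    show "mincoord \<sigma> x \<le> 1 / T"
      using mincoord_le[OF finite_simplex(1) finite_simplex(3)[OF j(1)], of x] xe[OF j(1)] j(2) by simp
    obtain a where "a \<in> \<sigma>" "x a = mincoord \<sigma> x" using mincoord_attained[OF finite_simplex(1,2)] .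
    then obtain i where i: "i \<le> d" "x (e i) = mincoord \<sigma> x" using enum_image by auto
    have "1 / T \<le> (1 + p i - m) / T" using m_le[OF i(1)] T by (intro divide_right_mono) auto
    then show "1 / T \<le> mincoord \<sigma> x" using i(2) xe[OF i(1)] by simp
  qed
  have w: "x (e i) - x (e 0) = p i / T" if "i \<le> d" for i
    using that by (simp add: xe diff_divide_distrib[symmetric] p_def)
  have "edge_sum d e x = (\<Sum>i\<in>{..d} - {0}. (x (e i) - x (e 0))\<^sup>2)"
    by (intro sum.mono_neutral_right) auto
  also have "\<dots> = (\<Sum>i\<in>{..d} - {0}. (y i)\<^sup>2 / ((1 - y 0) * T)\<^sup>2)"
    by (intro sum.cong) (auto simp: w p_def power_divide)
  also have "\<dots> = Y / ((1 - y 0) * T)\<^sup>2" by (simp add: Y_def sum_divide_distrib)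
  finally have sx: "edge_sum d e x = Y / ((1 - y 0) * T)\<^sup>2" .
  have ne: "1 - y 0 \<noteq> 0" "T \<noteq> 0" using lt T by auto
  have YY: "Y = (1 - y 0) * (1 + y 0)" using Y by (simp add: algebra_simps power2_eq_square)
  have sx': "edge_sum d e x = (1 + y 0) / ((1 - y 0) * T\<^sup>2)"
  proof -
    have "a * b / (a * T)\<^sup>2 = b / (a * T\<^sup>2)" if "a \<noteq> 0" for a b :: real
      using that by (simp add: power2_eq_square)
    then show ?thesis unfolding sx YY using ne(1) by blast
  qed
  have mincoord_sq: "(mincoord \<sigma> x)\<^sup>2 = (1 - y 0) / ((1 - y 0) * T\<^sup>2)"
    unfolding mincoord_eq using ne(1) by (simp add: power_divide)
  have D: "edge_sum d e x + (mincoord \<sigma> x)\<^sup>2 = 2 / ((1 - y 0) * T\<^sup>2)"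
    unfolding sx' mincoord_sq add_divide_distrib[symmetric] by simp
  have N: "edge_sum d e x - (mincoord \<sigma> x)\<^sup>2 = 2 * y 0 / ((1 - y 0) * T\<^sup>2)"
    unfolding sx' mincoord_sq diff_divide_distrib[symmetric] by simp
  have "simplex_to_sphere d e x i = y i" for i
  proof -
    consider "i = 0" | "0 < i" "i \<le> d" | "d < i" by linarith
    then show ?thesis
    proof cases
      case 1
      show ?thesis unfolding 1 simplex_to_sphere_simps(1) D N using ne by simp
    next
      case 2
      show ?thesis unfolding simplex_to_sphere_simps(2)[OF 2] D unfolding w[OF 2(2)] mincoord_eq
        using ne 2 by (simp add: p_def power2_eq_square)
    next
      case 3
      then show ?thesis using y0 by (simp add: simplex_to_sphere_simps(3))
    qed
  qed
  then have "simplex_to_sphere d e x = y" by blast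
  moreover have "mincoord \<sigma> x > 0" using mincoord_eq T by simp
  ultimately show thesis using that x by blast
qed

end

section \<open>Wedges of spheres\<close>

lemma continuous_map_from_sum_topology:
  assumes "\<And>i. i \<in> I \<Longrightarrow> continuous_map (X i) Z (\<lambda>x. f (i, x))"
  shows "continuous_map (sum_topology X I) Z f"
  unfolding continuous_map_def
proof (intro conjI funcsetI allI impI)
  show "f z \<in> topspace Z" if "z \<in> topspace (sum_topology X I)" for z
    using that assms by (auto simp: continuous_map_def Pi_iff)
  show "openin (sum_topology X I) {z \<in> topspace (sum_topology X I). f z \<in> U}" if U: "openin Z U" for U
    unfolding openin_sum_topology
  proof (intro conjI ballI)
    show "{z \<in> topspace (sum_topology X I). f z \<in> U} \<subseteq> Sigma I (topspace \<circ> X)" by auto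
    fix i assume i: "i \<in> I"
    then have "{x. (i, x) \<in> {z \<in> topspace (sum_topology X I). f z \<in> U}} =
        {x \<in> topspace (X i). f (i, x) \<in> U}" by auto
    then show "openin (X i) {x. (i, x) \<in> {z \<in> topspace (sum_topology X I). f z \<in> U}}"
      using assms[OF i] U by (simp add: continuous_map_def)
  qed
qed

lemma continuous_map_wedge_proj: "continuous_map (sum_topology X I) (wedge X I p) (wedge_proj p)"
  unfolding continuous_map_def openin_wedge topspace_wedge by blast

text \<open>The point \<open>None\<close> is present even when the sum is empty, so its image is
  constrained separately.\<close>

lemma continuous_map_from_wedge:
  assumes "continuous_map (sum_topology X I) Z (\<lambda>z. h (wedge_proj p z))" "h None \<in> topspace Z"
  shows "continuous_map (wedge X I p) Z h"
  unfolding continuous_map_def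
proof (intro conjI funcsetI allI impI)
  have in_Z: "h (wedge_proj p z) \<in> topspace Z" if "z \<in> topspace (sum_topology X I)" for z
    using assms(1) that unfolding continuous_map_def by blast
  then show "h w \<in> topspace Z" if "w \<in> topspace (wedge X I p)" for w
    using that assms(2) unfolding topspace_wedge by blast
  fix U assume U: "openin Z U"
  have "openin (sum_topology X I) {z \<in> topspace (sum_topology X I). h (wedge_proj p z) \<in> U}"
    using assms(1) U unfolding continuous_map_def by blast
  moreover have "{z \<in> topspace (sum_topology X I). h (wedge_proj p z) \<in> U} =
      {z \<in> topspace (sum_topology X I). wedge_proj p z \<in> {w \<in> topspace (wedge X I p). h w \<in> U}}"
    unfolding topspace_wedge by blast
  ultimately show "openin (wedge X I p) {w \<in> topspace (wedge X I p). h w \<in> U}"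
    unfolding openin_wedge topspace_wedge by (metis (no_types, lifting) mem_Collect_eq subsetI)
qed

text \<open>The wedge maps onto the coordinate axes of the product: a point of one summand is
  completed by the base points of all others. A continuous injection into a Hausdorff space yields
  the claim.\<close>

lemma Hausdorff_space_wedge:
  fixes X :: "'i \<Rightarrow> 'b topology"
  assumes X: "\<And>i. i \<in> I \<Longrightarrow> Hausdorff_space (X i)" and p: "\<And>i. i \<in> I \<Longrightarrow> p i \<in> topspace (X i)"
  shows "Hausdorff_space (wedge X I p)"
proof -
  let ?Z = "product_topology X I"
  define h where "h w = (\<lambda>j\<in>I. case w of None \<Rightarrow> p j | Some (i, s) \<Rightarrow> if j = i then s else p j)"
    for w :: "('i \<times> 'b) option"
  have hp: "h (wedge_proj p (i, s)) = (\<lambda>j\<in>I. if j = i then s else p j)" for i s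
    by (auto simp: h_def wedge_proj_def fun_eq_iff)
  have "continuous_map (wedge X I p) ?Z h"
  proof (rule continuous_map_from_wedge)
    show "h None \<in> topspace ?Z" using p by (auto simp: h_def)
    show "continuous_map (sum_topology X I) ?Z (\<lambda>z. h (wedge_proj p z))"
    proof (rule continuous_map_from_sum_topology)
      fix i assume i: "i \<in> I"
      show "continuous_map (X i) ?Z (\<lambda>s. h (wedge_proj p (i, s)))"
        unfolding hp continuous_map_componentwise
      proof (intro conjI ballI)
        show "(\<lambda>s. \<lambda>j\<in>I. if j = i then s else p j) ` topspace (X i) \<subseteq> extensional I" by auto
        show "continuous_map (X i) (X k) (\<lambda>s. (\<lambda>j\<in>I. if j = i then s else p j) k)" if "k \<in> I" for k
          using that p by (cases "k = i") (auto simp: continuous_map_const)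
      qed
    qed
  qed
  moreover have "inj_on h (topspace (wedge X I p))"
  proof (rule inj_onI)
    fix w w' assume w: "w \<in> topspace (wedge X I p)" "w' \<in> topspace (wedge X I p)" "h w = h w'"
    have val: "(\<forall>i s. w = Some (i, s) \<longrightarrow> i \<in> I \<and> s \<noteq> p i)" if "w \<in> topspace (wedge X I p)"
      for w :: "('i \<times> 'b) option"
      using that unfolding topspace_wedge wedge_proj_def by (auto split: if_splits)
    have ev: "h (Some (i, s)) i = s" "h None i = p i" "j \<noteq> i \<Longrightarrow> h (Some (j, s)) i = p i"
      if "i \<in> I" for i j s
      using that by (simp_all add: h_def)
    show "w = w'"
    proof (cases w)
      case None
      then show ?thesis
        using val[OF w(2)] ev w(3) by (cases w') (auto, metis)
    next
      case (Some a)
      obtain i s where a: "w = Some (i, s)" using Some by (cases a) auto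
      then have mem: "i \<in> I" "s \<noteq> p i" using val[OF w(1)] by auto
      have "h w' i = s" unfolding w(3)[symmetric] a by (rule ev(1)[OF mem(1)])
      then obtain i' s' where b: "w' = Some (i', s')" using ev(2)[OF mem(1)] mem(2) by (cases w') auto
      have "i' = i" using \<open>h w' i = s\<close> ev(3)[OF mem(1)] mem(2) b by metis
      then have "s' = s" using \<open>h w' i = s\<close> ev(1)[OF mem(1)] b by simp
      then show ?thesis using a b \<open>i' = i\<close> by simp
    qed
  qed
  moreover have "Hausdorff_space ?Z" using X by (simp add: Hausdorff_space_product_topology)
  ultimately show ?thesis using Hausdorff_space_injective_preimage by blast
qed

lemma Hausdorff_space_nsphere: "Hausdorff_space (nsphere n)"
  unfolding nsphere by (intro Hausdorff_space_subtopology) (simp add: Hausdorff_space_product_topology)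

section \<open>The quotient map onto the wedge\<close>

text \<open>The map \<open>q\<close> sends the complex without its facets to the wedge point and
  each open facet onto its own punctured sphere. It therefore identifies exactly the contractible
  part, and the extended contraction applies.\<close>

lemma realization_homotopy_equivalent_sphere_wedge:
  assumes X: "finite_complex X" and F: "\<And>\<sigma>. \<sigma> \<in> F \<Longrightarrow> maximal_simplex X \<sigma> \<and> \<sigma> \<noteq> {}"
    and contr: "contractible_space (geometric_realization (X - F))"
    and ne: "realization (X - F) \<noteq> {}"
    and dim: "\<And>\<sigma>. \<sigma> \<in> F \<Longrightarrow> card \<sigma> \<le> Suc d"
    and t: "\<And>i. i \<le> d \<Longrightarrow> t i = card {\<sigma> \<in> F. card \<sigma> = Suc i}"
  shows "geometric_realization X homotopy_equivalent_space sphere_wedge d t"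
proof -
  define K where "K = X - F"
  have K: "finite_complex K" unfolding K_def using F by (intro finite_complex_remove_facets[OF X]) blast
  have fin: "finite \<sigma>" "\<sigma> \<noteq> {}" "maximal_simplex X \<sigma>" "\<sigma> \<in> X" if "\<sigma> \<in> F" for \<sigma>
    using F[OF that] finite_complexD(2)[OF X] by (auto simp: maximal_simplex_def)
  have "F \<subseteq> X" using fin(4) by blast
  then have finF: "finite F" using finite_complexD(1)[OF X] finite_subset by blast
  obtain H p where H: "continuous_on ({0..1::real} \<times> realization X) H"
    "\<And>t x. t \<in> {0..1::real} \<Longrightarrow> x \<in> realization X \<Longrightarrow> H (t, x) \<in> realization X"
    "\<And>x. x \<in> realization X \<Longrightarrow> H (0, x) = x"
    "\<And>t x. t \<in> {0..1::real} \<Longrightarrow> x \<in> realization (X - F) \<Longrightarrow> H (t, x) \<in> realization (X - F)"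
    "\<And>x. x \<in> realization (X - F) \<Longrightarrow> H (1, x) = p"
    "p \<in> realization (X - F)"
    by (rule facet_homotopy_extension[of X F, OF X F contr ne]) (assumption, rule that)
  define I where "I = {(i, k). i \<le> d \<and> k < t i}"
  define base where "base = (\<lambda>_ :: nat \<times> nat. \<lambda>j :: nat. if j = 0 then 1 else 0 :: real)"
  let ?S = "\<lambda>(i, k :: nat). nsphere i"
  let ?W = "wedge ?S I base"
  have W: "sphere_wedge d t = ?W" by (simp add: sphere_wedge_def I_def base_def)
  have "\<exists>g. bij_betw g {..<t i} {\<sigma> \<in> F. card \<sigma> = Suc i}" if "i \<le> d" for i
    using ex_bij_betw_nat_finite[of "{\<sigma> \<in> F. card \<sigma> = Suc i}"] finF t[OF that]
    by (simp add: atLeast0LessThan)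
  then obtain g where g: "\<And>i. i \<le> d \<Longrightarrow> bij_betw (g i) {..<t i} {\<sigma> \<in> F. card \<sigma> = Suc i}"
    by metis
  define dm where "dm \<sigma> = card \<sigma> - 1" for \<sigma> :: "'a set"
  have dm: "card \<sigma> = Suc (dm \<sigma>)" "dm \<sigma> \<le> d" if "\<sigma> \<in> F" for \<sigma>
  proof -
    have "card \<sigma> > 0" using fin(1,2)[OF that] by (simp add: card_gt_0_iff)
    then show "card \<sigma> = Suc (dm \<sigma>)" "dm \<sigma> \<le> d" using dim[OF that] by (simp_all add: dm_def)
  qed
  \<comment> \<open>The index of the sphere belonging to a facet: its dimension, and its number in
    the enumeration \<open>g\<close> of the facets of that dimension.\<close>
  define \<iota> where "\<iota> \<sigma> = (dm \<sigma>, inv_into {..<t (dm \<sigma>)} (g (dm \<sigma>)) \<sigma>)" for \<sigma>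
  have \<iota>: "\<iota> \<sigma> \<in> I" "g (fst (\<iota> \<sigma>)) (snd (\<iota> \<sigma>)) = \<sigma>" if "\<sigma> \<in> F" for \<sigma>
  proof -
    have im: "g (dm \<sigma>) ` {..<t (dm \<sigma>)} = {\<tau> \<in> F. card \<tau> = Suc (dm \<sigma>)}"
      using g[OF dm(2)[OF that]] by (simp add: bij_betw_def)
    have mem: "\<sigma> \<in> g (dm \<sigma>) ` {..<t (dm \<sigma>)}" unfolding im using dm[OF that] that by simp
    show "\<iota> \<sigma> \<in> I" using inv_into_into[OF mem] dm(2)[OF that] by (simp add: \<iota>_def I_def)
    show "g (fst (\<iota> \<sigma>)) (snd (\<iota> \<sigma>)) = \<sigma>" using f_inv_into_f[OF mem] by (simp add: \<iota>_def)
  qed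
  have \<iota>_surj: "\<exists>\<sigma>\<in>F. \<iota> \<sigma> = (i, k)" if ik: "(i, k) \<in> I" for i k
  proof -
    have i: "i \<le> d" "k < t i" using ik by (simp_all add: I_def)
    have "g i k \<in> F" "card (g i k) = Suc i"
      using bij_betw_apply[OF g[OF i(1)], of k] i(2) by simp_all
    moreover have "\<iota> (g i k) = (i, k)"
      using calculation g[OF i(1)] i(2) by (simp add: \<iota>_def dm_def bij_betw_inv_into_left)
    ultimately show ?thesis by blast
  qed
  have "\<exists>e. bij_betw e {..dm \<sigma>} \<sigma>" if "\<sigma> \<in> F" for \<sigma>
    using ex_bij_betw_nat_finite[OF fin(1)[OF that]] dm(1)[OF that]
    by (simp add: atLeast0LessThan lessThan_Suc_atMost)
  then obtain e where e: "\<And>\<sigma>. \<sigma> \<in> F \<Longrightarrow> bij_betw (e \<sigma>) {..dm \<sigma>} \<sigma>" by metis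
  define \<phi> where "\<phi> \<sigma> = simplex_to_sphere (dm \<sigma>) (e \<sigma>)" for \<sigma>
  define q where "q x = (let \<sigma> = {v. x v \<noteq> 0} in if \<sigma> \<in> F then Some (\<iota> \<sigma>, \<phi> \<sigma> x) else None)"
    for x :: "'a \<Rightarrow> real"
  have faces: "realization (Pow \<sigma>) \<subseteq> realization X" if "\<sigma> \<in> F" for \<sigma>
    using finite_complexD(3)[OF X fin(4)[OF that]] by (auto simp: realization_def)
  have KX: "realization K \<subseteq> realization X" by (auto simp: realization_def K_def)
  have qK: "q x = None" if "x \<in> realization K" for x
    using realizationD(2)[OF that] by (simp add: q_def K_def)
  \<comment> \<open>On the boundary of a facet both sides are \<open>None\<close>:
    \<open>\<phi> \<sigma>\<close> takes the base point, and the support is a proper face, hence not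
    maximal.\<close>
  have q_facet: "q x = wedge_proj base (\<iota> \<sigma>, \<phi> \<sigma> x)" if \<sigma>: "\<sigma> \<in> F" and x: "x \<in> realization (Pow \<sigma>)" for \<sigma> x
  proof (cases "{v. x v \<noteq> 0} = \<sigma>")
    case True
    then have "mincoord \<sigma> x > 0" using mincoord_pos_iff[OF x fin(1,2)[OF \<sigma>]] by blast
    then have "\<phi> \<sigma> x \<noteq> base (\<iota> \<sigma>)"
      using simplex_to_sphere_base_iff[OF e[OF \<sigma>] x] by (simp add: \<phi>_def base_def)
    then show ?thesis using True \<sigma> by (simp add: q_def wedge_proj_def)
  next
    case False
    then have "\<not> \<sigma> \<subseteq> {v. x v \<noteq> 0}" using realizationD(2)[OF x] by blast
    then have "mincoord \<sigma> x = 0" using mincoord_pos_iff[OF x fin(1,2)[OF \<sigma>]] by linarith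
    then have "\<phi> \<sigma> x = base (\<iota> \<sigma>)"
      using simplex_to_sphere_base_iff[OF e[OF \<sigma>] x] by (simp add: \<phi>_def base_def)
    moreover have "{v. x v \<noteq> 0} \<notin> F"
      using realizationD(2)[OF x] False fin(3)[of "{v. x v \<noteq> 0}"] fin(4)[OF \<sigma>]
      unfolding maximal_simplex_def by blast
    ultimately show ?thesis by (simp add: q_def wedge_proj_def)
  qed
  have \<phi>_in: "(\<iota> \<sigma>, \<phi> \<sigma> x) \<in> topspace (sum_topology ?S I)" if "\<sigma> \<in> F" "x \<in> realization (Pow \<sigma>)" for \<sigma> x
    using simplex_to_sphere_in[OF e[OF that(1)] that(2)] \<iota>(1)[OF that(1)]
    by (simp add: \<phi>_def \<iota>_def)
  have cover: "x \<in> realization K \<or> (\<exists>\<sigma>\<in>F. {v. x v \<noteq> 0} = \<sigma> \<and> x \<in> realization (Pow \<sigma>))"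
    if "x \<in> realization X" for x
    using that by (auto simp: realization_def K_def)
  have cont: "continuous_map (top_of_set (realization X)) ?W q"
  \<comment> \<open>Finitely many closed pieces cover the realization: the remaining complex, where
    \<open>q\<close> is constant, and the closed facets, where \<open>q_facet\<close> makes it a
    composition of continuous maps.\<close>
  proof (rule pasting_lemma_closed[where I = "insert K (Pow ` F)" and T = realization and f = "\<lambda>_. q"])
    show "finite (insert K (Pow ` F))" using finF by simp
    fix L assume L: "L \<in> insert K (Pow ` F)"
    have L_complex: "finite_complex L" using L K finite_complex_Pow[OF fin(1)] by blast
    have sub: "realization L \<subseteq> realization X" using L faces KX by blast
    show "closedin (top_of_set (realization X)) (realization L)"
      using closed_subset[OF sub closed_realization[OF L_complex]] .
    have eq: "subtopology (top_of_set (realization X)) (realization L) = top_of_set (realization L)"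
      using sub by (simp add: subtopology_subtopology Int_absorb1)
    show "continuous_map (subtopology (top_of_set (realization X)) (realization L)) ?W q"
    proof (cases "L = K")
      case True
      have "continuous_map (top_of_set (realization L)) ?W (\<lambda>_. None)"
        by (simp add: topspace_wedge)
      then show ?thesis unfolding eq by (rule continuous_map_eq) (use qK True in simp)
    next
      case False
      then obtain \<sigma> where \<sigma>: "\<sigma> \<in> F" "L = Pow \<sigma>" using L by blast
      have "continuous_map (top_of_set (realization L)) (nsphere (dm \<sigma>)) (\<phi> \<sigma>)"
        unfolding nsphere \<phi>_def \<sigma>(2)
        using continuous_on_simplex_to_sphere[OF e[OF \<sigma>(1)]] simplex_to_sphere_in[OF e[OF \<sigma>(1)]]
        by (auto simp: euclidean_product_topology nsphere image_subset_iff)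
      moreover have "continuous_map (nsphere (dm \<sigma>)) (sum_topology ?S I) (Pair (\<iota> \<sigma>))"
        using continuous_map_component_injection[OF \<iota>(1)[OF \<sigma>(1)], of ?S] by (simp add: \<iota>_def)
      ultimately have "continuous_map (top_of_set (realization L)) ?W
          (wedge_proj base \<circ> (Pair (\<iota> \<sigma>) \<circ> \<phi> \<sigma>))"
        by (intro continuous_map_compose[OF _ continuous_map_wedge_proj] continuous_map_compose)
      then show ?thesis unfolding eq using q_facet[OF \<sigma>(1)] \<sigma>(2)
        by (elim continuous_map_eq) simp
    qed
  next
    show "\<exists>L. L \<in> insert K (Pow ` F) \<and> x \<in> realization L \<and> q x = q x"
      if "x \<in> topspace (top_of_set (realization X))" for x
      using cover[of x] that by auto
  qed auto
  have image: "q ` realization X = topspace ?W"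
  proof
    show "q ` realization X \<subseteq> topspace ?W" using cont by (simp add: continuous_map_def image_subset_iff Pi_iff)
    show "topspace ?W \<subseteq> q ` realization X"
    proof
      fix w assume w: "w \<in> topspace ?W"
      have None: "None \<in> q ` realization X" using qK[of p] H(6) KX unfolding K_def by (metis image_eqI subsetD)
      show "w \<in> q ` realization X"
      proof (cases w)
        case None
        then show ?thesis using \<open>None \<in> q ` realization X\<close> by simp
      next
        case (Some a)
        obtain i k s where iks: "(i, k) \<in> I" "s \<in> topspace (nsphere i)" "w = wedge_proj base ((i, k), s)"
          "s \<noteq> base (i, k)"
          using w Some unfolding topspace_wedge by (auto simp: wedge_proj_def split: if_splits)
        obtain \<sigma> where \<sigma>: "\<sigma> \<in> F" "\<iota> \<sigma> = (i, k)" using \<iota>_surj[OF iks(1)] by blast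
        then have i: "i = dm \<sigma>" by (simp add: \<iota>_def)
        obtain x where x: "x \<in> realization (Pow \<sigma>)" "\<phi> \<sigma> x = s"
          using simplex_to_sphere_surj[OF e[OF \<sigma>(1)], of s] iks(2,4) unfolding i base_def \<phi>_def by blast
        have "q x = w" using q_facet[OF \<sigma>(1) x(1)] x(2) \<sigma>(2) iks(3) by simp
        then show ?thesis using faces[OF \<sigma>(1)] x(1) by blast
      qed
    qed
  qed
  have inj: "x = y \<or> x \<in> realization K \<and> y \<in> realization K"
    if x: "x \<in> realization X" and y: "y \<in> realization X" and eq: "q x = q y" for x y
  proof (cases "{v. x v \<noteq> 0} \<in> F")
    case False
    then have "q y = None" using eq by (simp add: q_def)
    then have "{v. y v \<noteq> 0} \<notin> F" by (auto simp: q_def Let_def split: if_splits)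
    then show ?thesis using False x y by (auto simp: realization_def K_def)
  next
    case True
    define \<sigma> where "\<sigma> = {v. x v \<noteq> 0}"
    have \<sigma>: "\<sigma> \<in> F" using True by (simp add: \<sigma>_def)
    have qx: "q x = Some (\<iota> \<sigma>, \<phi> \<sigma> x)" using True by (simp add: q_def \<sigma>_def Let_def)
    define \<tau> where "\<tau> = {v. y v \<noteq> 0}"
    have \<tau>: "\<tau> \<in> F" "q y = Some (\<iota> \<tau>, \<phi> \<tau> y)"
      using qx eq by (auto simp: q_def \<tau>_def Let_def split: if_splits)
    have "\<iota> \<sigma> = \<iota> \<tau>" and same: "\<phi> \<sigma> x = \<phi> \<tau> y" using qx \<tau>(2) eq by simp_all
    then have "\<sigma> = \<tau>" by (metis \<iota>(2)[OF \<sigma>] \<iota>(2)[OF \<tau>(1)])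
    have xP: "x \<in> realization (Pow \<sigma>)" using x by (simp add: realization_def \<sigma>_def)
    have yP: "y \<in> realization (Pow \<sigma>)" using y unfolding \<open>\<sigma> = \<tau>\<close> by (simp add: realization_def \<tau>_def)
    have "mincoord \<sigma> x > 0" using mincoord_pos_iff(2)[OF xP fin(1,2)[OF \<sigma>]] by (simp add: \<sigma>_def)
    moreover have "mincoord \<sigma> y > 0"
      using mincoord_pos_iff(2)[OF yP fin(1,2)[OF \<sigma>]] unfolding \<open>\<sigma> = \<tau>\<close> by (simp add: \<tau>_def)
    ultimately have "x = y"
      using simplex_to_sphere_inj[OF e[OF \<sigma>] xP _ yP] same unfolding \<open>\<sigma> = \<tau>\<close> \<phi>_def by blast
    then show ?thesis ..
  qed
  show ?thesis
    unfolding geometric_realization_eq W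
  proof (rule quotient_homotopy_equivalent[where q = q and A = "realization K" and H = H and p = p])
    show "compact_space (top_of_set (realization X))" using X by (rule compact_space_realization)
    show "Hausdorff_space ?W"
      by (rule Hausdorff_space_wedge) (auto simp: Hausdorff_space_nsphere base_def sphere_base_point)
    show "continuous_map (prod_topology (top_of_set {0..1::real}) (top_of_set (realization X)))
        (top_of_set (realization X)) H"
      using H(1,2) by (auto simp: image_subset_iff)
    show "x = y \<or> x \<in> realization K \<and> y \<in> realization K"
      if "x \<in> topspace (top_of_set (realization X))" "y \<in> topspace (top_of_set (realization X))" "q x = q y"
      for x y
      using inj that by simp
  qed (use cont image qK H(3-5) in \<open>auto simp: K_def\<close>)
qed

section \<open>Grid graphs\<close>

text \<open>Distinct vertices are nonadjacent iff one index strictly increases while the other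
  strictly decreases. With \<open>b x = n - g x\<close>, an order reversal because
  \<open>g x \<le> n\<close>, this is strict comparability in both coordinates.\<close>

lemma grid_graph_chains:
  fixes G :: "'a pair_pre_digraph"
  assumes "grid_graph m n G"
  obtains a b :: "'a \<Rightarrow> nat" where
    "finite (pverts G)"
    "independence_complex G = grid_chains a b (pverts G)"
    "\<forall>x\<in>pverts G. a x \<le> m \<and> b x \<le> n"
    "\<forall>p\<le>m. \<forall>q\<le>n. \<exists>u\<in>pverts G. a u = p \<and> b u = q"
proof -
  obtain W where G: "pair_graph G" and V: "pverts G = (\<Union>i\<le>m. \<Union>j\<le>n. W i j)"
    and disj: "disjoint_family_on (\<lambda>(i, j). W i j) ({..m} \<times> {..n})"
    and ne: "\<forall>i\<le>m. \<forall>j\<le>n. W i j \<noteq> {}"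
    and adj: "\<forall>i1\<le>m. \<forall>j1\<le>n. \<forall>i2\<le>m. \<forall>j2\<le>n. \<forall>x\<in>W i1 j1. \<forall>y\<in>W i2 j2. x \<noteq> y \<longrightarrow>
        ((x, y) \<in> parcs G \<longleftrightarrow> i1 \<le> i2 \<and> j1 \<le> j2 \<or> i1 \<ge> i2 \<and> j1 \<ge> j2)"
    using assms unfolding grid_graph_def by (elim conjE exE)
  have "\<exists>i j. i \<le> m \<and> j \<le> n \<and> x \<in> W i j" if "x \<in> pverts G" for x
    using that unfolding V by blast
  then obtain f g where fg: "\<And>x. x \<in> pverts G \<Longrightarrow> f x \<le> m \<and> g x \<le> n \<and> x \<in> W (f x) (g x)"
    by metis
  have cell: "f x = i \<and> g x = j" if "i \<le> m" "j \<le> n" "x \<in> W i j" for x i j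
  proof -
    have "x \<in> pverts G" using that unfolding V by blast
    note x = fg[OF this]
    have "W (f x) (g x) \<inter> W i j = {}" if "(f x, g x) \<noteq> (i, j)"
      using disjoint_family_onD[OF disj, of "(f x, g x)" "(i, j)"] x \<open>i \<le> m\<close> \<open>j \<le> n\<close> that by simp
    then show ?thesis using x \<open>x \<in> W i j\<close> by blast
  qed
  define b where "b x = n - g x" for x
  show thesis
  proof
    show "finite (pverts G)"
      using G by (simp add: pair_graph_def pair_digraph_def pair_fin_digraph.pair_finite_verts)
    have comp: "(x, y) \<notin> parcs G \<longleftrightarrow> f x < f y \<and> b x < b y \<or> f y < f x \<and> b y < b x"
      if "x \<in> pverts G" "y \<in> pverts G" "x \<noteq> y" for x y
    proof -
      note x = fg[OF that(1)] and y = fg[OF that(2)]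
      have "(x, y) \<in> parcs G \<longleftrightarrow> f x \<le> f y \<and> g x \<le> g y \<or> f x \<ge> f y \<and> g x \<ge> g y"
        using adj[rule_format, of "f x" "g x" "f y" "g y" x y] x y that(3) by blast
      then show ?thesis using x y unfolding b_def by auto
    qed
    show "independence_complex G = grid_chains f b (pverts G)"
      unfolding independence_complex_def grid_chains_def
      using comp by (intro Collect_cong conj_cong refl ball_cong imp_cong) (auto dest: subsetD)
    show "\<forall>x\<in>pverts G. f x \<le> m \<and> b x \<le> n" using fg by (simp add: b_def)
    show "\<forall>p\<le>m. \<forall>q\<le>n. \<exists>u\<in>pverts G. f u = p \<and> b u = q"
    proof (intro allI impI)
      fix p q assume pq: "p \<le> m" "q \<le> n"
      obtain u where u: "u \<in> W p (n - q)" using ne[rule_format, of p "n - q"] pq by auto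
      then have "u \<in> pverts G" unfolding V using pq by force
      moreover have "f u = p \<and> g u = n - q" using cell[of p "n - q" u] u pq by simp
      ultimately show "\<exists>u\<in>pverts G. f u = p \<and> b u = q"
        using pq by (intro bexI[of _ u]) (auto simp: b_def)
    qed
  qed
qed

text \<open>Each coordinate is injective on a chain.\<close>

lemma card_grid_chain_le:
  assumes "S \<in> grid_chains a b V" "finite V" "\<And>x. x \<in> V \<Longrightarrow> a x \<le> m \<and> b x \<le> n"
  shows "card S \<le> Suc (min m n)"
proof -
  have S: "S \<subseteq> V" using assms(1) by (rule grid_chains_subset)
  have "a x \<noteq> a y \<and> b x \<noteq> b y" if "x \<in> S" "y \<in> S" "x \<noteq> y" for x y
  proof -
    have "a x < a y \<and> b x < b y \<or> a y < a x \<and> b y < b x"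
      using assms(1) that unfolding grid_chains_def by simp
    then show ?thesis by auto
  qed
  then have "inj_on a S" "inj_on b S" by (meson inj_onI)+
  moreover have "a ` S \<subseteq> {..m}" "b ` S \<subseteq> {..n}" using S assms(3) by auto
  ultimately have "card S \<le> card {..m}" "card S \<le> card {..n}"
    using card_inj_on_le[of a S "{..m}"] card_inj_on_le[of b S "{..n}"] by blast+
  then show ?thesis by simp
qed

text \<open>One vertex from each diagonal cell \<open>(k, k)\<close> with
  \<open>k \<le> min m n\<close> gives a chain.\<close>

lemma grid_chain_exists:
  assumes "\<And>p q. p \<le> m \<Longrightarrow> q \<le> n \<Longrightarrow> \<exists>u\<in>V. a u = p \<and> b u = q"
  shows "\<exists>S\<in>grid_chains a b V. card S = Suc (min m n)"
proof -
  have "\<exists>u. u \<in> V \<and> a u = k \<and> b u = k" if "k \<le> min m n" for k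
    using assms[of k k] that by auto
  then obtain u where u: "\<And>k. k \<le> min m n \<Longrightarrow> u k \<in> V \<and> a (u k) = k \<and> b (u k) = k" by metis
  have "inj_on u {..min m n}" using u by (intro inj_onI) (metis atMost_iff)
  then have "card (u ` {..min m n}) = Suc (min m n)" by (simp add: card_image)
  moreover have "u ` {..min m n} \<in> grid_chains a b V"
    unfolding grid_chains_def
  proof (intro CollectI conjI ballI impI)
    show "u ` {..min m n} \<subseteq> V" using u by blast
    fix x y assume xy: "x \<in> u ` {..min m n}" "y \<in> u ` {..min m n}" "x \<noteq> y"
    then obtain k l where "k \<le> min m n" "l \<le> min m n" "x = u k" "y = u l" by auto
    then show "a x < a y \<and> b x < b y \<or> a y < a x \<and> b y < b x"
      using u[of k] u[of l] xy(3) by (cases k l rule: linorder_cases) auto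
  qed
  ultimately show ?thesis by blast
qed

text \<open>The pairs exhaust \<open>X - F\<close>, so a critical simplex outside \<open>F\<close>
  must be the partner of the empty simplex, which is unique because pairs are disjoint.\<close>

lemma critical_simplex_iff:
  assumes M: "expansion (X - F) M" and F: "F \<subseteq> X" and u: "({}, {u}) \<in> M"
  shows "critical_simplex X M \<sigma> \<longleftrightarrow> \<sigma> = {u} \<or> \<sigma> \<in> F"
proof
  have cover: "Domain M \<union> Range M = X - F" and am: "acyclic_matching (X - F) M"
    using expansion_matching[OF M] by blast+
  assume c: "critical_simplex X M \<sigma>"
  show "\<sigma> = {u} \<or> \<sigma> \<in> F"
  proof (cases "\<sigma> \<in> F")
    case False
    then have "\<sigma> \<in> Domain M \<union> Range M" using c cover by (simp add: critical_simplex_def)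
    then have mem: "({}, \<sigma>) \<in> M" using c unfolding critical_simplex_def by blast
    have uniq: "\<forall>(\<alpha>, \<beta>)\<in>M. \<forall>(\<alpha>', \<beta>')\<in>M. {\<alpha>, \<beta>} \<inter> {\<alpha>', \<beta>'} \<noteq> {} \<longrightarrow> (\<alpha>, \<beta>) = (\<alpha>', \<beta>')"
      using am unfolding acyclic_matching_def by (elim conjE)
    have "({}, \<sigma>) = ({}, {u})"
      using bspec[OF bspec[OF uniq mem, unfolded case_prod_conv] u, unfolded case_prod_conv] by blast
    then show ?thesis by simp
  qed simp
next
  have "\<alpha> \<noteq> \<sigma> \<and> \<beta> \<noteq> \<sigma>" if "\<sigma> \<in> F" "(\<alpha>, \<beta>) \<in> M" for \<alpha> \<beta>
    using expansion_pair_mem[OF M that(2)] that(1) by blast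
  moreover have "{} \<notin> F" using expansion_empty_mem[OF M] by blast
  moreover have "{u} \<in> X" using expansion_pair_mem[OF M u] by blast
  moreover assume "\<sigma> = {u} \<or> \<sigma> \<in> F"
  ultimately show "critical_simplex X M \<sigma>"
    using F u unfolding critical_simplex_def by blast
qed

theorem theorem3p8:
  fixes m n :: nat and G :: "'a pair_pre_digraph"
  assumes "grid_graph m n G"
  shows "complex_dim (independence_complex G) = int (min m n) \<and>
    (\<exists>M. acyclic_matching (independence_complex G) M \<and>
      (\<exists>\<tau>\<in>independence_complex G. sdim \<tau> = 0 \<and>
        (\<forall>\<sigma>. critical_simplex (independence_complex G) M \<sigma> \<and> \<sigma> \<noteq> \<tau> \<longrightarrow>
          maximal_simplex (independence_complex G) \<sigma>)) \<and>
      (card (pverts G) \<ge> 2 \<longrightarrow>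
        geometric_realization (independence_complex G) homotopy_equivalent_space
        sphere_wedge (min m n)
          (\<lambda>i. if i = 0 then num_critical (independence_complex G) M 0 - 1
               else num_critical (independence_complex G) M i)))"
proof -
  obtain a b :: "'a \<Rightarrow> nat" where fin: "finite (pverts G)"
    and chains: "independence_complex G = grid_chains a b (pverts G)"
    and "\<forall>x\<in>pverts G. a x \<le> m \<and> b x \<le> n"
    and "\<forall>p\<le>m. \<forall>q\<le>n. \<exists>u\<in>pverts G. a u = p \<and> b u = q"
    using grid_graph_chains[OF assms] .
  then have bound: "\<And>x. x \<in> pverts G \<Longrightarrow> a x \<le> m \<and> b x \<le> n"
    and cells: "\<And>p q. p \<le> m \<Longrightarrow> q \<le> n \<Longrightarrow> \<exists>u\<in>pverts G. a u = p \<and> b u = q"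
    by blast+
  define X where "X = independence_complex G"
  have X: "finite_complex X" unfolding X_def chains using fin by (rule finite_complex_grid_chains)
  have card_le: "card S \<le> Suc (min m n)" if "S \<in> X" for S
    using card_grid_chain_le[of S a b "pverts G" m n] that fin bound unfolding X_def chains by blast
  obtain S0 where S0: "S0 \<in> X" "card S0 = Suc (min m n)"
    using grid_chain_exists[of m n "pverts G" a b] cells unfolding X_def chains by blast
  have dim: "complex_dim X = int (min m n)"
    unfolding complex_dim_def
  proof (rule Max_eqI)
    show "finite (sdim ` X)" using finite_complexD(1)[OF X] by simp
    show "s \<le> int (min m n)" if "s \<in> sdim ` X" for s using that card_le by (force simp: sdim_def)
    have "sdim S0 = int (min m n)" using S0(2) by (simp add: sdim_def)
    then show "int (min m n) \<in> sdim ` X" using S0(1) by (metis imageI)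
  qed
  have region: "region a b (pverts G) 0 0 = pverts G" by (simp add: region_def)
  have "\<exists>u\<in>pverts G. a u = p \<and> b u = q" if "x \<in> pverts G" "p \<le> a x" "q \<le> b x" for x p q
    using bound[OF that(1)] that(2,3) by (intro cells) auto
  moreover have "pverts G \<noteq> {}" using cells[of 0 0] by blast
  ultimately obtain M F where M: "expansion (X - F) M" and F: "\<And>\<sigma>. \<sigma> \<in> F \<Longrightarrow> maximal_simplex X \<sigma>"
    using grid_chains_expansion[of "pverts G" a b 0 0] fin unfolding region X_def chains by blast
  obtain u where u: "({}, {u}) \<in> M" using expansion_matching(4)[OF M] by blast
  have uX: "{u} \<in> X - F" using expansion_pair_mem[OF M u] by blast
  have FX: "F \<subseteq> X" using F by (auto simp: maximal_simplex_def)
  have neF: "\<sigma> \<noteq> {}" if "\<sigma> \<in> F" for \<sigma> using that expansion_empty_mem[OF M] by blast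
  have crit: "critical_simplex X M \<sigma> \<longleftrightarrow> \<sigma> = {u} \<or> \<sigma> \<in> F" for \<sigma>
    using critical_simplex_iff[OF M FX u] .
  have finF: "finite F" using FX finite_complexD(1)[OF X] finite_subset by blast
  \<comment> \<open>In dimension 0 the vertex \<open>{u}\<close>, paired with the empty simplex,
    counts as critical but is not in \<open>F\<close>; subtracting 1 leaves exactly the deleted
    facets.\<close>
  have num: "(if i = 0 then num_critical X M 0 - 1 else num_critical X M i) =
      card {\<sigma> \<in> F. card \<sigma> = Suc i}" for i
  proof -
    have "{\<sigma>. critical_simplex X M \<sigma> \<and> sdim \<sigma> = int i} =
        (if i = 0 then insert {u} {\<sigma> \<in> F. card \<sigma> = Suc i} else {\<sigma> \<in> F. card \<sigma> = Suc i})"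
      unfolding crit sdim_def by auto
    then have "num_critical X M i =
        card (if i = 0 then insert {u} {\<sigma> \<in> F. card \<sigma> = Suc i} else {\<sigma> \<in> F. card \<sigma> = Suc i})"
      by (simp only: num_critical_def)
    then show ?thesis using uX finF by (cases "i = 0") simp_all
  qed
  have "(\<lambda>v. if v = u then 1 else 0) \<in> realization (X - F)"
    by (rule realizationI[OF finite_complex_remove_facets[OF X F] uX]) auto
  then have ne: "realization (X - F) \<noteq> {}" by blast
  have "geometric_realization X homotopy_equivalent_space sphere_wedge (min m n)
      (\<lambda>i. if i = 0 then num_critical X M 0 - 1 else num_critical X M i)"
    using F neF FX card_le
    by (intro realization_homotopy_equivalent_sphere_wedge[OF X _ expansion_contractible[OF M] ne] num)
      auto
  moreover have "acyclic_matching X M" using X M F by (rule acyclic_matching_add_facets)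
  moreover have "{u} \<in> X" "sdim {u} = 0" using uX by (simp_all add: sdim_def)
  moreover have "maximal_simplex X \<sigma>" if "critical_simplex X M \<sigma>" "\<sigma> \<noteq> {u}" for \<sigma>
    using that F crit by blast
  ultimately show ?thesis
    using dim unfolding X_def by blast
qed

end
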